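(* Let $P$ be a finite poset with maximum. Then there exists a basic $\mathbb{N}$-graded Gorenstein tiled order $A$ over $R=k[x]$ all of whose $b$-invariants are $1$ or $2$ such that the endomorphism algebra of the standard tilting object $V$ in $\underline{\mathrm{CM}}^{\mathbb{Z}}A$ is isomorphic to the incidence algebra $kP$.
   Context: Let $k$ be a field, $R=k[x]$, $K=k[x,x^{-1}]$, graded by $\deg x=1$. Modules are right modules. For a $\mathbb{Z}$-graded vector space $M$, $M(1)_n=M_{n+1}$ and $M_{\ge 0}=\bigoplus_{n\ge 0}M_n$. A tiled order (over $R$) of size $n\geq 1$ is an $R$-subalgebra $A=[Rx^{d(i,j)}]_{1\le i,j\le n}\subseteq \mathrm{M}_n(K)$ with integers $d(i,j)$ satisfying $d(i,i)=0$ and $d(i,l)+d(l,j)\ge d(i,j)$ for all $i,j,l$. It is $\mathbb{Z}$-graded by $\mathrm{M}_n(K)_j=\mathrm{M}_n(k)x^j$; it is $\mathbb{N}$-graded iff all $d(i,j)\ge 0$, and basic iff $d(i,j)+d(j,i)>0$ for all $i\ne j$. Let $e_i$ be the diagonal matrix units and put $\mathbb{I}=\{1,\dots,n\}$. A basic tiled order is Gorenstein iff there is a (unique) bijection $\nu:\mathbb{I}\to\mathbb{I}$ (the Nakayama permutation) with $d(\nu i,j)+d(j,i)=d(\nu i,i)$ for all $i,j\in\mathbb{I}$. The integers $d(\nu i,i)$ are the $b$-invariants; put $p_i=1-d(\nu i,i)$. $\mathrm{CM}^{\mathbb{Z}}A$ is the Frobenius category of finitely generated graded $A$-modules that are projective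 over $R$, with degree-$0$ homomorphisms, and $\underline{\mathrm{CM}}^{\mathbb{Z}}A$ is its stable category (modulo maps factoring through graded projectives). The standard tilting object is $V=[R\ \cdots\ R]\oplus\bigoplus_{i\in\mathbb{I}}\bigoplus_{j=1}^{-p_i}e_{\nu i}A(j)_{\ge 0}$ ($n$ entries in the row module $[R\ \cdots\ R]$; empty sums are zero). For a finite poset $P$, the incidence algebra $kP$ has basis $\{(y,x): x\le y\}$ with $(z,y)(y,x)=(z,x)$ and all other products zero; so $e_y(kP)e_x\neq0$ iff $x\le y$ (paths in the Hasse quiver, with arrows going upward, are composed like maps). *)

theory Defs
  imports
    "HOL-Algebra.QuotRing"
    "HOL-Algebra.Module"
    "HOL-Library.Poly_Mapping"
    "HOL-Combinatorics.Permutations"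
    "Jordan_Normal_Form.Matrix"
begin

hide_const (open) Multiset.mult

section \<open>Graded rings and graded right modules\<close>

record 'a graded = "'a ring" +
  hcomp :: "int \<Rightarrow> 'a set"

text \<open>Following the convention of the record type \<open>module\<close> of the library, modules reuse the
  record type \<open>ring\<close> for their additive structure; the fields \<open>mult\<close> and \<open>one\<close> of a module are
  never used. The scalars act on the right.\<close>

record ('a, 'm) gmodule = "'m graded" +
  ract :: "'m \<Rightarrow> 'a \<Rightarrow> 'm"

definition right_module :: "('a, 'x) ring_scheme \<Rightarrow> ('a, 'm) gmodule \<Rightarrow> bool" where
  "right_module A M \<longleftrightarrow> abelian_group M \<and>
    (\<forall>m\<in>carrier M. \<forall>a\<in>carrier A. ract M m a \<in> carrier M) \<and>
    (\<forall>m\<in>carrier M. \<forall>m'\<in>carrier M. \<forall>a\<in>carrier A.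
       ract M (m \<oplus>\<^bsub>M\<^esub> m') a = ract M m a \<oplus>\<^bsub>M\<^esub> ract M m' a) \<and>
    (\<forall>m\<in>carrier M. \<forall>a\<in>carrier A. \<forall>b\<in>carrier A.
       ract M m (a \<oplus>\<^bsub>A\<^esub> b) = ract M m a \<oplus>\<^bsub>M\<^esub> ract M m b) \<and>
    (\<forall>m\<in>carrier M. \<forall>a\<in>carrier A. \<forall>b\<in>carrier A.
       ract M m (a \<otimes>\<^bsub>A\<^esub> b) = ract M (ract M m a) b) \<and>
    (\<forall>m\<in>carrier M. ract M m \<one>\<^bsub>A\<^esub> = m)"

definition graded_right_module :: "('a, 'x) graded_scheme \<Rightarrow> ('a, 'm) gmodule \<Rightarrow> bool" where
  "graded_right_module A M \<longleftrightarrow> right_module A M \<and>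
    (\<forall>n. additive_subgroup (hcomp M n) M) \<and>
    (\<forall>m\<in>carrier M. \<exists>!c. (\<forall>n. c n \<in> hcomp M n) \<and> finite {n. c n \<noteq> \<zero>\<^bsub>M\<^esub>} \<and>
       m = finsum M c {n. c n \<noteq> \<zero>\<^bsub>M\<^esub>}) \<and>
    (\<forall>n j. \<forall>m\<in>hcomp M n. \<forall>a\<in>hcomp A j. ract M m a \<in> hcomp M (n + j))"

definition module_hom ::
  "('a, 'x) ring_scheme \<Rightarrow> ('a, 'm) gmodule \<Rightarrow> ('a, 'l) gmodule \<Rightarrow> ('m \<Rightarrow> 'l) set" where
  "module_hom A M N = {f \<in> carrier M \<rightarrow>\<^sub>E carrier N.
    (\<forall>m\<in>carrier M. \<forall>m'\<in>carrier M. f (m \<oplus>\<^bsub>M\<^esub> m') = f m \<oplus>\<^bsub>N\<^esub> f m') \<and>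
    (\<forall>m\<in>carrier M. \<forall>a\<in>carrier A. f (ract M m a) = ract N (f m) a)}"

definition graded_hom ::
  "('a, 'x) ring_scheme \<Rightarrow> ('a, 'm) gmodule \<Rightarrow> ('a, 'l) gmodule \<Rightarrow> ('m \<Rightarrow> 'l) set" where
  "graded_hom A M N = {f \<in> module_hom A M N. \<forall>n. f ` hcomp M n \<subseteq> hcomp N n}"

definition regular_module :: "('a, 'x) graded_scheme \<Rightarrow> ('a, 'a) gmodule" where
  "regular_module A = \<lparr>carrier = carrier A, mult = mult A, one = \<one>\<^bsub>A\<^esub>, zero = \<zero>\<^bsub>A\<^esub>, add = add A,
     hcomp = hcomp A, ract = mult A\<rparr>"

definition shift_module :: "int \<Rightarrow> ('a, 'm) gmodule \<Rightarrow> ('a, 'm) gmodule" where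
  "shift_module s M = M\<lparr>hcomp := (\<lambda>n. hcomp M (n + s))\<rparr>"

definition nonneg_part :: "('a, 'm) gmodule \<Rightarrow> ('a, 'm) gmodule" where
  "nonneg_part M = M\<lparr>
     carrier := {finsum M c F | c F. finite F \<and> F \<subseteq> {0..} \<and> (\<forall>n\<in>F. c n \<in> hcomp M n)},
     hcomp := (\<lambda>n. if 0 \<le> n then hcomp M n else {\<zero>\<^bsub>M\<^esub>})\<rparr>"

text \<open>Only used for finite index sets \<open>I\<close>, where direct sums and direct products agree.\<close>

definition direct_sum_module ::
  "'i set \<Rightarrow> ('i \<Rightarrow> ('a, 'm) gmodule) \<Rightarrow> ('a, 'i \<Rightarrow> 'm) gmodule" where
  "direct_sum_module I M = \<lparr>carrier = (\<Pi>\<^sub>E i\<in>I. carrier (M i)),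
     mult = undefined, one = undefined,
     zero = (\<lambda>i\<in>I. \<zero>\<^bsub>M i\<^esub>),
     add = (\<lambda>u v. \<lambda>i\<in>I. u i \<oplus>\<^bsub>M i\<^esub> v i),
     hcomp = (\<lambda>n. \<Pi>\<^sub>E i\<in>I. hcomp (M i) n),
     ract = (\<lambda>u a. \<lambda>i\<in>I. ract (M i) (u i) a)\<rparr>"

definition fin_gen :: "('a, 'x) ring_scheme \<Rightarrow> ('a, 'm) gmodule \<Rightarrow> bool" where
  "fin_gen A M \<longleftrightarrow> (\<exists>S. finite S \<and> S \<subseteq> carrier M \<and>
    (\<forall>m\<in>carrier M. \<exists>a \<in> S \<rightarrow> carrier A. m = finsum M (\<lambda>s. ract M s (a s)) S))"

text \<open>Finitely generated projective modules, as direct summands of free modules of finite rank;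
  in the graded case, of finite direct sums of shifts of the regular module.\<close>

definition fg_projective :: "('a, 'x) graded_scheme \<Rightarrow> ('a, 'm) gmodule \<Rightarrow> bool" where
  "fg_projective A P \<longleftrightarrow> right_module A P \<and>
    (\<exists>r::nat. let F = direct_sum_module {..<r} (\<lambda>i. regular_module A) in
       \<exists>\<iota> \<in> module_hom A P F. \<exists>\<pi> \<in> module_hom A F P.
         compose (carrier P) \<pi> \<iota> = (\<lambda>m\<in>carrier P. m))"

definition graded_projective :: "('a, 'x) graded_scheme \<Rightarrow> ('a, 'm) gmodule \<Rightarrow> bool" where
  "graded_projective A P \<longleftrightarrow> graded_right_module A P \<and>
    (\<exists>(r::nat) s. let F = direct_sum_module {..<r} (\<lambda>i. shift_module (s i) (regular_module A)) in
       \<exists>\<iota> \<in> graded_hom A P F. \<exists>\<pi> \<in> graded_hom A F P.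
         compose (carrier P) \<pi> \<iota> = (\<lambda>m\<in>carrier P. m))"

text \<open>The projective module is allowed to live on any set of functions \<open>nat \<Rightarrow> 'a\<close>. This is no
  restriction: every finitely generated projective module is isomorphic to a submodule of some
  \<open>A\<^sup>r\<close>, hence to a module of this kind.\<close>

definition factors_through_projective ::
  "('a, 'x) graded_scheme \<Rightarrow> ('a, 'm) gmodule \<Rightarrow> ('a, 'l) gmodule \<Rightarrow> ('m \<Rightarrow> 'l) \<Rightarrow> bool" where
  "factors_through_projective A M N f \<longleftrightarrow>
    (\<exists>P :: ('a, nat \<Rightarrow> 'a) gmodule. graded_projective A P \<and>
      (\<exists>g \<in> graded_hom A M P. \<exists>h \<in> graded_hom A P N. f = compose (carrier M) h g))"

definition restrict_scalars :: "('b \<Rightarrow> 'a) \<Rightarrow> ('a, 'm) gmodule \<Rightarrow> ('b, 'm) gmodule" where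
  "restrict_scalars \<phi> M = \<lparr>carrier = carrier M, mult = mult M, one = \<one>\<^bsub>M\<^esub>, zero = \<zero>\<^bsub>M\<^esub>,
     add = add M, hcomp = hcomp M, ract = (\<lambda>m b. ract M m (\<phi> b))\<rparr>"


section \<open>Laurent polynomials and tiled orders\<close>

text \<open>The group algebra of the integers: \<open>k[x,x\<^sup>-\<^sup>1]\<close>, with \<open>c x\<^sup>j\<close> given by
  \<open>Poly_Mapping.single j c\<close>.\<close>

type_synonym 'k laurent = "int \<Rightarrow>\<^sub>0 'k"

definition poly_ring :: "'k::field laurent graded" where
  "poly_ring = \<lparr>carrier = {f. Poly_Mapping.keys f \<subseteq> {0..}}, mult = (*), one = 1, zero = 0, add = (+),
     hcomp = (\<lambda>j. {Poly_Mapping.single j c | c. Poly_Mapping.keys (Poly_Mapping.single j c) \<subseteq> {0..}})\<rparr>"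

definition homogeneous_mat :: "int \<Rightarrow> 'k::field laurent mat \<Rightarrow> bool" where
  "homogeneous_mat j m \<longleftrightarrow>
    (\<forall>s<dim_row m. \<forall>t<dim_col m. \<exists>c. m $$ (s, t) = Poly_Mapping.single j c)"

text \<open>The index set \<open>{1,\<dots>,n}\<close> becomes \<open>{..<n}\<close>, as usual for this matrix type; values of \<open>d\<close>
  outside are irrelevant.\<close>

definition tiled_order_exponents :: "nat \<Rightarrow> (nat \<Rightarrow> nat \<Rightarrow> int) \<Rightarrow> bool" where
  "tiled_order_exponents n d \<longleftrightarrow> 1 \<le> n \<and> (\<forall>i<n. d i i = 0) \<and>
    (\<forall>i<n. \<forall>l<n. \<forall>j<n. d i l + d l j \<ge> d i j)"

definition tiled_order :: "nat \<Rightarrow> (nat \<Rightarrow> nat \<Rightarrow> int) \<Rightarrow> 'k::field laurent mat graded" where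
  "tiled_order n d =
    (let A = {m \<in> carrier_mat n n. \<forall>i<n. \<forall>j<n.
                m $$ (i, j) \<in> (\<lambda>r. r * Poly_Mapping.single (d i j) 1) ` carrier poly_ring}
     in \<lparr>carrier = A, mult = (*), one = 1\<^sub>m n, zero = 0\<^sub>m n n, add = (+),
         hcomp = (\<lambda>j. {m \<in> A. homogeneous_mat j m})\<rparr>)"

definition nonneg_graded :: "nat \<Rightarrow> (nat \<Rightarrow> nat \<Rightarrow> int) \<Rightarrow> bool" where
  "nonneg_graded n d \<longleftrightarrow> (\<forall>i<n. \<forall>j<n. d i j \<ge> 0)"

definition basic :: "nat \<Rightarrow> (nat \<Rightarrow> nat \<Rightarrow> int) \<Rightarrow> bool" where
  "basic n d \<longleftrightarrow> (\<forall>i<n. \<forall>j<n. i \<noteq> j \<longrightarrow> d i j + d j i > 0)"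

definition nakayama_condition :: "nat \<Rightarrow> (nat \<Rightarrow> nat \<Rightarrow> int) \<Rightarrow> (nat \<Rightarrow> nat) \<Rightarrow> bool" where
  "nakayama_condition n d \<nu> \<longleftrightarrow> \<nu> permutes {..<n} \<and>
    (\<forall>i<n. \<forall>j<n. d (\<nu> i) j + d j i = d (\<nu> i) i)"

definition gorenstein :: "nat \<Rightarrow> (nat \<Rightarrow> nat \<Rightarrow> int) \<Rightarrow> bool" where
  "gorenstein n d \<longleftrightarrow> (\<exists>\<nu>. nakayama_condition n d \<nu>)"

lemma nakayama_unique:
  assumes "basic n d" "nakayama_condition n d \<nu>" "nakayama_condition n d \<nu>'"
  shows "\<nu> = \<nu>'"
proof
  fix i
  show "\<nu> i = \<nu>' i"
  proof (cases "i < n")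
    case True
    then have lt: "\<nu> i < n" "\<nu>' i < n"
      using assms(2,3) permutes_in_image unfolding nakayama_condition_def by (metis lessThan_iff)+
    have "d (\<nu> i) (\<nu>' i) + d (\<nu>' i) i = d (\<nu> i) i" "d (\<nu>' i) (\<nu> i) + d (\<nu> i) i = d (\<nu>' i) i"
      using assms(2,3) lt True unfolding nakayama_condition_def by auto
    then have "d (\<nu> i) (\<nu>' i) + d (\<nu>' i) (\<nu> i) = 0" by linarith
    then show ?thesis using assms(1) lt unfolding basic_def by fastforce
  next
    case False
    then show ?thesis using assms(2,3) unfolding nakayama_condition_def permutes_def by auto
  qed
qed

definition nakayama :: "nat \<Rightarrow> (nat \<Rightarrow> nat \<Rightarrow> int) \<Rightarrow> nat \<Rightarrow> nat" where
  "nakayama n d = (THE \<nu>. nakayama_condition n d \<nu>)"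

definition b_invariant :: "nat \<Rightarrow> (nat \<Rightarrow> nat \<Rightarrow> int) \<Rightarrow> nat \<Rightarrow> int" where
  "b_invariant n d i = d (nakayama n d i) i"

definition p_invariant :: "nat \<Rightarrow> (nat \<Rightarrow> nat \<Rightarrow> int) \<Rightarrow> nat \<Rightarrow> int" where
  "p_invariant n d i = 1 - b_invariant n d i"

definition CM_object ::
  "nat \<Rightarrow> (nat \<Rightarrow> nat \<Rightarrow> int) \<Rightarrow> ('k::field laurent mat, 'm) gmodule \<Rightarrow> bool" where
  "CM_object n d M \<longleftrightarrow> graded_right_module (tiled_order n d) M \<and> fin_gen (tiled_order n d) M \<and>
    fg_projective poly_ring (restrict_scalars (\<lambda>r. r \<cdot>\<^sub>m 1\<^sub>m n) M)"


section \<open>The standard tilting object\<close>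

definition matrix_module ::
  "nat \<Rightarrow> nat \<Rightarrow> 'k::field laurent mat set \<Rightarrow> ('k laurent mat, 'k laurent mat) gmodule" where
  "matrix_module nr nc C = \<lparr>carrier = C, mult = undefined, one = undefined,
     zero = 0\<^sub>m nr nc, add = (+), hcomp = (\<lambda>j. {m \<in> C. homogeneous_mat j m}), ract = (*)\<rparr>"

definition row_module :: "nat \<Rightarrow> ('k::field laurent mat, 'k laurent mat) gmodule" where
  "row_module n = matrix_module 1 n {m \<in> carrier_mat 1 n. \<forall>j<n. m $$ (0, j) \<in> carrier poly_ring}"

definition idem :: "nat \<Rightarrow> nat \<Rightarrow> 'k::field laurent mat" where
  "idem n i = mat n n (\<lambda>(s, t). if s = i \<and> t = i then 1 else 0)"

definition indec_projective ::
  "nat \<Rightarrow> (nat \<Rightarrow> nat \<Rightarrow> int) \<Rightarrow> nat \<Rightarrow> ('k::field laurent mat, 'k laurent mat) gmodule" where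
  "indec_projective n d i = matrix_module n n ((\<lambda>a. idem n i * a) ` carrier (tiled_order n d))"

definition tilting_index :: "nat \<Rightarrow> (nat \<Rightarrow> nat \<Rightarrow> int) \<Rightarrow> (nat \<times> int) option set" where
  "tilting_index n d = insert None {Some (i, j) | i j. i < n \<and> 1 \<le> j \<and> j \<le> - p_invariant n d i}"

fun tilting_summand ::
  "nat \<Rightarrow> (nat \<Rightarrow> nat \<Rightarrow> int) \<Rightarrow> (nat \<times> int) option \<Rightarrow> ('k::field laurent mat, 'k laurent mat) gmodule"
where
  "tilting_summand n d None = row_module n"
| "tilting_summand n d (Some (i, j)) =
     nonneg_part (shift_module j (indec_projective n d (nakayama n d i)))"

definition standard_tilting ::
  "nat \<Rightarrow> (nat \<Rightarrow> nat \<Rightarrow> int) \<Rightarrow>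
   ('k::field laurent mat, (nat \<times> int) option \<Rightarrow> 'k laurent mat) gmodule" where
  "standard_tilting n d = direct_sum_module (tilting_index n d) (tilting_summand n d)"


section \<open>Stable endomorphism algebras and incidence algebras\<close>

text \<open>\<open>k\<close>-algebras, not necessarily commutative, are represented by the record type \<open>module\<close> with
  all of its ring and module fields in use.\<close>

definition graded_End ::
  "nat \<Rightarrow> (nat \<Rightarrow> nat \<Rightarrow> int) \<Rightarrow> ('k::field laurent mat, 'm) gmodule \<Rightarrow> ('k, 'm \<Rightarrow> 'm) module" where
  "graded_End n d M = \<lparr>carrier = graded_hom (tiled_order n d) M M,
     mult = compose (carrier M), one = (\<lambda>m\<in>carrier M. m),
     zero = (\<lambda>m\<in>carrier M. \<zero>\<^bsub>M\<^esub>), add = (\<lambda>f g. \<lambda>m\<in>carrier M. f m \<oplus>\<^bsub>M\<^esub> g m),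
     smult = (\<lambda>c f. \<lambda>m\<in>carrier M. ract M (f m) (Poly_Mapping.single 0 c \<cdot>\<^sub>m 1\<^sub>m n))\<rparr>"

definition quotient_algebra :: "('k, 'b) module \<Rightarrow> 'b set \<Rightarrow> ('k, 'b set) module" where
  "quotient_algebra E I = \<lparr>carrier = carrier (E Quot I), mult = mult (E Quot I),
     one = \<one>\<^bsub>E Quot I\<^esub>, zero = \<zero>\<^bsub>E Quot I\<^esub>, add = add (E Quot I),
     smult = (\<lambda>c X. \<Union>f\<in>X. I +>\<^bsub>E\<^esub> (c \<odot>\<^bsub>E\<^esub> f))\<rparr>"

definition stable_End ::
  "nat \<Rightarrow> (nat \<Rightarrow> nat \<Rightarrow> int) \<Rightarrow> ('k::field laurent mat, 'm) gmodule \<Rightarrow> ('k, ('m \<Rightarrow> 'm) set) module"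
where
  "stable_End n d M = quotient_algebra (graded_End n d M)
     {f \<in> carrier (graded_End n d M). factors_through_projective (tiled_order n d) M M f}"

text \<open>Elements are coefficient functions with respect to the basis \<open>{(y, x). x \<le> y}\<close>; the order
  relation \<open>r\<close> contains \<open>(x, y)\<close> iff \<open>x \<le> y\<close>.\<close>

definition incidence_algebra :: "'p set \<Rightarrow> 'p rel \<Rightarrow> ('k::field, 'p \<times> 'p \<Rightarrow> 'k) module" where
  "incidence_algebra P r = \<lparr>carrier = {f. \<forall>y x. f (y, x) \<noteq> 0 \<longrightarrow> (x, y) \<in> r},
     mult = (\<lambda>f g (z, x). \<Sum>y\<in>P. f (z, y) * g (y, x)),
     one = (\<lambda>(y, x). if y = x \<and> x \<in> P then 1 else 0),
     zero = (\<lambda>_. 0), add = (\<lambda>f g u. f u + g u),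
     smult = (\<lambda>c f u. c * f u)\<rparr>"

definition algebra_isomorphic :: "('k, 'b) module \<Rightarrow> ('k, 'c) module \<Rightarrow> bool" where
  "algebra_isomorphic E F \<longleftrightarrow>
    (\<exists>h \<in> ring_iso E F. \<forall>c. \<forall>a\<in>carrier E. h (c \<odot>\<^bsub>E\<^esub> a) = c \<odot>\<^bsub>F\<^esub> h a)"

end

theory Submission
  imports Defs
begin

text \<open>
  Write \<open>L\<^sub>v\<close> for the row lattice \<open>[R x\<^bsup>v 1\<^esup> \<dots> R x\<^bsup>v n\<^esup>]\<close>. It is a right module over the tiled
  order iff \<open>v j \<le> v i + d i j\<close> for all \<open>i, j\<close>, and a homomorphism \<open>L\<^sub>v \<rightarrow> L\<^sub>w\<close> of degree \<open>0\<close> is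
  multiplication by a scalar, which must vanish unless \<open>w \<le> v\<close> pointwise (lemma \<open>End_gen\<close>). So
  up to scalars the category of row lattices is a poset, and the endomorphism algebra of a direct sum of
  pairwise different row lattices is an incidence algebra (lemma \<open>mat_act_bij\<close>). All summands
  of the standard tilting object are of this kind: \<open>[R \<dots> R]\<close> has \<open>v = 0\<close>, and the nonnegative
  part of \<open>e\<^bsub>\<nu> i\<^esub> A(j)\<close> has \<open>v t = max (d (\<nu> i) t - j) 0\<close>. If all \<open>b\<close>-invariants are \<open>1\<close> or \<open>2\<close>,
  only \<open>j = 1\<close> occurs, for those \<open>i\<close> with \<open>d (\<nu> i) i = 2\<close>; then \<open>d (\<nu> i) t + d t i = 2\<close> shows that
  \<open>v\<close> is the indicator function of the set \<open>{t. d t i = 0}\<close>.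

  Given \<open>P\<close> with maximum, let \<open>Q\<close> be the rest of \<open>P\<close>. An element \<open>p\<close> of \<open>P\<close> is determined by the set
  of all \<open>z \<in> Q\<close> with \<open>p \<le> z\<close>, and \<open>p \<le> p'\<close> iff the set of \<open>p'\<close> is contained in that of \<open>p\<close>; the
  maximum has the empty set, so it corresponds to \<open>[R \<dots> R]\<close>. It remains to find a tiled order whose
  sets \<open>{t. d t i = 0}\<close> are these. With the \<open>Q \<times> Q\<close> matrix \<open>D\<close> that has \<open>D z q = 0\<close> if \<open>q \<le> z\<close> and
  \<open>D z q = 1\<close> otherwise, the block matrix with rows \<open>(D, 1 - D\<^sup>T)\<close> and \<open>(2 - D\<^sup>T, D)\<close> does it: transitivity
  of the order is the triangle inequality for \<open>D\<close>, antisymmetry makes the order basic, and the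
  Nakayama permutation exchanges the two blocks, with \<open>b\<close>-invariants \<open>2\<close> on the first block
  and \<open>1\<close> on the second (lemma \<open>nontrivial_poset_realization\<close>). If \<open>P\<close> has a single element, this
  block matrix is empty, and the order of size two with off-diagonal exponents \<open>1\<close> takes its
  place (lemma \<open>singleton_poset_realization\<close>).

  Passing to the stable category does not change the endomorphism algebra, because a map
  from \<open>V\<close> to itself that factors through a graded projective is zero. Indeed, it suffices to
  consider \<open>V \<rightarrow> A(s) \<rightarrow> V\<close>. A map \<open>A(s) \<rightarrow> V\<close> is given by an element of \<open>V\<close> of degree \<open>-s\<close>, so it vanishes
  for \<open>s > 0\<close> since \<open>V\<close> lives in nonnegative degrees (lemma \<open>hom_from_pos_shift\<close>). For \<open>s \<le> 0\<close>, a nonzero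
  map \<open>V \<rightarrow> A(s)\<close> would give a nonzero map from some \<open>L\<^sub>v\<close> to some \<open>e\<^sub>k A(s)\<close>, which forces \<open>d k \<le> v\<close>; but
  every row \<open>d k\<close> of the order has an entry, in column \<open>\<nu>\<^sup>-\<^sup>1 k\<close>, that exceeds all the corresponding
  \<open>v t\<close> (lemma \<open>hom_to_nonpos_shift\<close>).
\<close>

section \<open>Laurent polynomials with bounded order\<close>

text \<open>Membership in the fractional ideal \<open>R x\<^sup>N\<close> of \<open>k[x,x\<^sup>-\<^sup>1]\<close>.\<close>

definition supp_ge :: "int \<Rightarrow> 'k::field laurent \<Rightarrow> bool" where
  "supp_ge N f \<longleftrightarrow> Poly_Mapping.keys f \<subseteq> {N..}"

lemma supp_ge_zero [simp]: "supp_ge N 0"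
  by (simp add: supp_ge_def)

lemma supp_ge_single [simp]: "supp_ge N (Poly_Mapping.single j c) \<longleftrightarrow> c = 0 \<or> N \<le> j"
  by (simp add: supp_ge_def)

lemma supp_ge_one [simp]: "supp_ge N 1 \<longleftrightarrow> N \<le> 0"
  by (simp add: supp_ge_def)

lemma supp_ge_mono: "supp_ge N f \<Longrightarrow> M \<le> N \<Longrightarrow> supp_ge M f"
  by (auto simp: supp_ge_def)

lemma supp_ge_add: "supp_ge N f \<Longrightarrow> supp_ge N g \<Longrightarrow> supp_ge N (f + g)"
  unfolding supp_ge_def using Poly_Mapping.keys_add[of f g] by blast

lemma supp_ge_uminus: "supp_ge N f \<Longrightarrow> supp_ge N (- f)"
  unfolding supp_ge_def by (auto simp: in_keys_iff)

lemma supp_ge_mult: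
  assumes "supp_ge N f" "supp_ge M g" "L \<le> N + M"
  shows "supp_ge L (f * g)"
  using assms keys_mult[of f g] unfolding supp_ge_def by fastforce

lemma supp_ge_sum: "(\<And>i. i \<in> I \<Longrightarrow> supp_ge N (f i)) \<Longrightarrow> supp_ge N (sum f I)"
  by (induction I rule: infinite_finite_induct) (auto intro: supp_ge_add)

lemma single_cancel [simp]:
  fixes f :: "'k::field laurent"
  shows "f * Poly_Mapping.single N 1 * Poly_Mapping.single (- N) 1 = f"
    "f * Poly_Mapping.single (- N) 1 * Poly_Mapping.single N 1 = f"
  by (simp_all add: mult.assoc mult_single)

lemma supp_ge_times_single:
  fixes f :: "'k::field laurent"
  assumes "supp_ge N f" "L \<le> N + M"
  shows "supp_ge L (f * Poly_Mapping.single M 1)"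
  using assms by (intro supp_ge_mult[of N _ M]) auto

definition homog :: "int \<Rightarrow> 'k::field laurent \<Rightarrow> bool" where
  "homog j f \<longleftrightarrow> (\<exists>c. f = Poly_Mapping.single j c)"

lemma homog_single [simp]: "homog j (Poly_Mapping.single j c)"
  by (auto simp: homog_def)

lemma homog_zero [simp]: "homog j 0"
  unfolding homog_def by (metis single_zero)

lemma homog_add: "homog j f \<Longrightarrow> homog j g \<Longrightarrow> homog j (f + g)"
  unfolding homog_def by (metis single_add)

lemma homog_uminus: "homog j f \<Longrightarrow> homog j (- f)"
  unfolding homog_def by (metis single_uminus)

lemma homog_mult: "homog i f \<Longrightarrow> homog j g \<Longrightarrow> l = i + j \<Longrightarrow> homog l (f * g)"
  unfolding homog_def by (auto simp: mult_single)

lemma homog_sum: "(\<And>i. i \<in> I \<Longrightarrow> homog N (f i)) \<Longrightarrow> homog N (sum f I)"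
  by (induction I rule: infinite_finite_induct) (auto intro: homog_add)

lemma homog_supp_ge_zero: "homog j f \<Longrightarrow> supp_ge N f \<Longrightarrow> j < N \<Longrightarrow> f = 0"
  by (auto simp: homog_def)

lemma homog_eq: "homog j f \<longleftrightarrow> f = Poly_Mapping.single j (Poly_Mapping.lookup f j)"
  unfolding homog_def by (metis lookup_single_eq)

lemma homog_lookup: "homog j f \<Longrightarrow> Poly_Mapping.lookup f i = (if i = j then Poly_Mapping.lookup f j else 0)"
  by (auto simp: homog_def lookup_single)

lemma homogeneous_mat_iff:
  "homogeneous_mat j m \<longleftrightarrow> (\<forall>s<dim_row m. \<forall>t<dim_col m. homog j (m $$ (s, t)))"
  by (simp add: homogeneous_mat_def homog_def)

lemma single_neq_0: "0 \<noteq> (Poly_Mapping.single N 1 :: 'k::field laurent)"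
  by (metis lookup_single_eq lookup_zero zero_neq_one)

lemma supp_ge_lookup: "supp_ge N f \<Longrightarrow> Poly_Mapping.lookup f j \<noteq> 0 \<Longrightarrow> N \<le> j"
  by (auto simp: supp_ge_def in_keys_iff)

lemma single_sum: "Poly_Mapping.single k (sum F S) = (\<Sum>x\<in>S. Poly_Mapping.single k (F x))"
  by (induction S rule: infinite_finite_induct) (simp_all add: single_add)

text \<open>This is how truncating a graded lattice at degree \<open>M\<close> raises the exponents below \<open>M\<close> to \<open>M\<close>.\<close>

lemma homog_supp_ge_max: "homog j f \<Longrightarrow> supp_ge N f \<Longrightarrow> M \<le> j \<Longrightarrow> supp_ge (max N M) f"
  by (auto simp: homog_def)

lemma sum_monomials:
  assumes "finite K" "Poly_Mapping.keys f \<subseteq> K"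
  shows "(\<Sum>i\<in>K. Poly_Mapping.single i (Poly_Mapping.lookup f i)) = f"
proof (rule poly_mapping_eqI)
  fix k
  have "Poly_Mapping.lookup (\<Sum>i\<in>K. Poly_Mapping.single i (Poly_Mapping.lookup f i)) k
      = (\<Sum>i\<in>K. if i = k then Poly_Mapping.lookup f k else 0)"
    unfolding lookup_sum by (intro sum.cong) (auto simp: lookup_single)
  then show "Poly_Mapping.lookup (\<Sum>i\<in>K. Poly_Mapping.single i (Poly_Mapping.lookup f i)) k
      = Poly_Mapping.lookup f k"
    using assms by (auto simp: in_keys_iff)
qed

section \<open>Tiled orders\<close>

lemma mat_mult_entry:
  assumes "A \<in> carrier_mat r n" "B \<in> carrier_mat n c" "i < r" "j < c"
  shows "(A * B) $$ (i, j) = (\<Sum>l<n. A $$ (i, l) * B $$ (l, j))"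
  using assms by (simp add: scalar_prod_def atLeast0LessThan)

lemma poly_ring_carrier: "f \<in> carrier poly_ring \<longleftrightarrow> supp_ge 0 f"
  by (simp add: poly_ring_def supp_ge_def)

lemma shifted_poly_iff:
  fixes f :: "'k::field laurent"
  shows "f \<in> (\<lambda>r. r * Poly_Mapping.single N 1) ` carrier poly_ring \<longleftrightarrow> supp_ge N f"
proof
  assume "supp_ge N f"
  then have "f * Poly_Mapping.single (- N) 1 \<in> carrier poly_ring"
    unfolding poly_ring_carrier by (intro supp_ge_times_single) auto
  then show "f \<in> (\<lambda>r. r * Poly_Mapping.single N 1) ` carrier poly_ring"
    by (intro image_eqI[of _ _ "f * Poly_Mapping.single (- N) 1"]) auto
qed (auto simp: poly_ring_carrier intro: supp_ge_times_single)

lemma tiled_order_carrier: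
  "a \<in> carrier (tiled_order n d) \<longleftrightarrow>
    a \<in> carrier_mat n n \<and> (\<forall>i<n. \<forall>j<n. supp_ge (d i j) (a $$ (i, j)))"
  by (simp add: tiled_order_def Let_def shifted_poly_iff)

lemma tiled_order_sel [simp]:
  "mult (tiled_order n d) = (*)" "\<one>\<^bsub>tiled_order n d\<^esub> = 1\<^sub>m n" "\<zero>\<^bsub>tiled_order n d\<^esub> = 0\<^sub>m n n"
  "add (tiled_order n d) = (+)"
  "hcomp (tiled_order n d) j = {m \<in> carrier (tiled_order n d). homogeneous_mat j m}"
  by (simp_all add: tiled_order_def Let_def)

definition mat_unit :: "nat \<Rightarrow> nat \<Rightarrow> nat \<Rightarrow> 'k::field laurent \<Rightarrow> 'k laurent mat" where
  "mat_unit n i j f = mat n n (\<lambda>(s, t). if s = i \<and> t = j then f else 0)"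

lemma mat_unit_carrier:
  "i < n \<Longrightarrow> j < n \<Longrightarrow> mat_unit n i j f \<in> carrier (tiled_order n d) \<longleftrightarrow> supp_ge (d i j) f"
  by (auto simp: tiled_order_carrier mat_unit_def)

lemma mat_unit_mat [simp]: "mat_unit n i j f \<in> carrier_mat n n"
  by (simp add: mat_unit_def)

lemma mat_unit_entry: "s < n \<Longrightarrow> t < n \<Longrightarrow> mat_unit n i j f $$ (s, t) = (if s = i \<and> t = j then f else 0)"
  by (simp add: mat_unit_def)

lemma times_mat_unit_entry:
  assumes "m \<in> carrier_mat r n" "i < n" "s < r" "t < n"
  shows "(m * mat_unit n i j f) $$ (s, t) = (if t = j then m $$ (s, i) * f else 0)"
proof -
  have "(m * mat_unit n i j f) $$ (s, t) = (\<Sum>l<n. if l = i then (if t = j then m $$ (s, i) * f else 0) else 0)"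
    unfolding mat_mult_entry[OF assms(1) mat_unit_mat assms(3,4)]
    using assms by (intro sum.cong) (auto simp: mat_unit_entry)
  then show ?thesis using assms(2) by simp
qed

lemma tiled_order_mult_closed:
  assumes "tiled_order_exponents n d" "a \<in> carrier (tiled_order n d)" "b \<in> carrier (tiled_order n d)"
  shows "a * b \<in> carrier (tiled_order n d)"
proof -
  have "supp_ge (d i j) ((a * b) $$ (i, j))" if "i < n" "j < n" for i j
  proof -
    have "(a * b) $$ (i, j) = (\<Sum>l<n. a $$ (i, l) * b $$ (l, j))"
      using assms that by (intro mat_mult_entry) (auto simp: tiled_order_carrier)
    moreover have "supp_ge (d i j) (\<Sum>l<n. a $$ (i, l) * b $$ (l, j))"
      using assms that unfolding tiled_order_exponents_def tiled_order_carrier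
      by (intro supp_ge_sum supp_ge_mult) auto
    ultimately show ?thesis by simp
  qed
  then show ?thesis using assms by (auto simp: tiled_order_carrier)
qed

lemma tiled_order_add_closed:
  "a \<in> carrier (tiled_order n d) \<Longrightarrow> b \<in> carrier (tiled_order n d) \<Longrightarrow> a + b \<in> carrier (tiled_order n d)"
  by (auto simp: tiled_order_carrier intro!: supp_ge_add)

lemma tiled_order_one_closed:
  "tiled_order_exponents n d \<Longrightarrow> 1\<^sub>m n \<in> carrier (tiled_order n d)"
  by (auto simp: tiled_order_carrier tiled_order_exponents_def)

lemma smult_one_carrier:
  "tiled_order_exponents n d \<Longrightarrow> supp_ge 0 f \<Longrightarrow> f \<cdot>\<^sub>m 1\<^sub>m n \<in> carrier (tiled_order n d)"
  by (auto simp: tiled_order_carrier tiled_order_exponents_def)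

lemma abelian_group_cong:
  assumes "abelian_group M" "carrier N = carrier M" "add N = add M" "\<zero>\<^bsub>N\<^esub> = \<zero>\<^bsub>M\<^esub>"
  shows "abelian_group N"
  by (rule abelian_groupI) (use abelian_groupE[OF assms(1)] assms(2-4) in auto)

lemma smult_one_mult:
  fixes a b :: "'a::comm_ring_1"
  shows "(a * b) \<cdot>\<^sub>m 1\<^sub>m n = (a \<cdot>\<^sub>m 1\<^sub>m n) * (b \<cdot>\<^sub>m 1\<^sub>m n)"
proof -
  have "(a \<cdot>\<^sub>m 1\<^sub>m n) * (b \<cdot>\<^sub>m 1\<^sub>m n) = a \<cdot>\<^sub>m (1\<^sub>m n * (b \<cdot>\<^sub>m 1\<^sub>m n))"
    by (intro mult_smult_assoc_mat[of _ n n _ n]) auto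
  also have "\<dots> = (a * b) \<cdot>\<^sub>m 1\<^sub>m n" by (intro eq_matI) auto
  finally show ?thesis by simp
qed

lemma smult_one_add:
  fixes a b :: "'a::comm_ring_1"
  shows "(a + b) \<cdot>\<^sub>m 1\<^sub>m n = (a \<cdot>\<^sub>m 1\<^sub>m n) + (b \<cdot>\<^sub>m 1\<^sub>m n)"
  by (intro eq_matI) (auto simp: distrib_right)

section \<open>Direct sums of row lattices\<close>

text \<open>A finite family of row lattices, indexed by \<open>X\<close>. The summand of \<open>x\<close> consists of matrices with \<open>nr x\<close>
  rows of which only row \<open>\<rho> x\<close> can be nonzero: \<open>[R \<dots> R]\<close> consists of \<open>1 \<times> n\<close> matrices, whereas \<open>e\<^sub>k A\<close> lies
  in the \<open>n \<times> n\<close> matrices and occupies row \<open>k\<close>. The grading of the summand is shifted by \<open>sh x\<close>, and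
  the exponents \<open>v x\<close> are normalised so that \<open>v x t\<close> is the least degree, with respect to the
  shifted grading, of a nonzero element concentrated in column \<open>t\<close>. In other words, in that grading
  the summand is \<open>L\<^bsub>v x\<^esub>\<close>.\<close>

locale row_lattices =
  fixes n :: nat and d :: "nat \<Rightarrow> nat \<Rightarrow> int" and X :: "'i set"
    and nr \<rho> :: "'i \<Rightarrow> nat" and sh :: "'i \<Rightarrow> int" and v :: "'i \<Rightarrow> nat \<Rightarrow> int"
    and M :: "'i \<Rightarrow> ('k::field laurent mat, 'k laurent mat) gmodule"
  assumes tiled: "tiled_order_exponents n d"
    and finite_index: "finite X"
    and row: "\<And>x. x \<in> X \<Longrightarrow> \<rho> x < nr x"
    and lattice: "\<And>x i j. x \<in> X \<Longrightarrow> i < n \<Longrightarrow> j < n \<Longrightarrow> v x j \<le> v x i + d i j"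
    and M_carrier: "\<And>x. x \<in> X \<Longrightarrow> carrier (M x) = {m \<in> carrier_mat (nr x) n. \<forall>s<nr x. \<forall>t<n.
        if s = \<rho> x then supp_ge (v x t + sh x) (m $$ (s, t)) else m $$ (s, t) = 0}"
    and M_zero: "\<And>x. x \<in> X \<Longrightarrow> \<zero>\<^bsub>M x\<^esub> = 0\<^sub>m (nr x) n"
    and M_add: "\<And>x. x \<in> X \<Longrightarrow> add (M x) = (+)"
    and M_hcomp: "\<And>x j. x \<in> X \<Longrightarrow> hcomp (M x) j = {m \<in> carrier (M x). homogeneous_mat (j + sh x) m}"
    and M_ract: "\<And>x. x \<in> X \<Longrightarrow> ract (M x) = (*)"
begin

abbreviation A :: "'k laurent mat graded" where "A \<equiv> tiled_order n d"

definition V :: "('k laurent mat, 'i \<Rightarrow> 'k laurent mat) gmodule" where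
  "V = direct_sum_module X M"

text \<open>An element of the direct sum is described by its coordinates, which are the entries in the
  relevant rows, shifted so that the degrees of \<open>V\<close> become the degrees of Laurent polynomials.
  The whole structure of \<open>V\<close> is then computed coordinatewise.\<close>

definition coord :: "('i \<Rightarrow> 'k laurent mat) \<Rightarrow> 'i \<Rightarrow> nat \<Rightarrow> 'k laurent" where
  "coord u x t = u x $$ (\<rho> x, t) * Poly_Mapping.single (- sh x) 1"

definition from_coord :: "('i \<Rightarrow> nat \<Rightarrow> 'k laurent) \<Rightarrow> 'i \<Rightarrow> 'k laurent mat" where
  "from_coord \<Phi> = (\<lambda>x\<in>X. mat (nr x) n
     (\<lambda>(s, t). if s = \<rho> x then \<Phi> x t * Poly_Mapping.single (sh x) 1 else 0))"

lemma n_pos: "0 < n" and d_diag [simp]: "i < n \<Longrightarrow> d i i = 0"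
  using tiled by (auto simp: tiled_order_exponents_def)

lemma V_carrier: "u \<in> carrier V \<longleftrightarrow> u \<in> extensional X \<and> (\<forall>x\<in>X. u x \<in> carrier (M x))"
  by (auto simp: V_def direct_sum_module_def PiE_def Pi_def)

lemma V_zero: "x \<in> X \<Longrightarrow> \<zero>\<^bsub>V\<^esub> x = 0\<^sub>m (nr x) n"
  by (simp add: V_def direct_sum_module_def M_zero)

lemma V_zero_ext: "\<zero>\<^bsub>V\<^esub> \<in> extensional X"
  by (simp add: V_def direct_sum_module_def)

lemma V_add: "x \<in> X \<Longrightarrow> (u \<oplus>\<^bsub>V\<^esub> w) x = u x + w x"
  by (simp add: V_def direct_sum_module_def M_add)

lemma V_add_ext: "u \<oplus>\<^bsub>V\<^esub> w \<in> extensional X"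
  by (simp add: V_def direct_sum_module_def)

lemma V_ract: "x \<in> X \<Longrightarrow> ract V u a x = u x * a"
  by (simp add: V_def direct_sum_module_def M_ract)

lemma V_ract_ext: "ract V u a \<in> extensional X"
  by (simp add: V_def direct_sum_module_def)

lemma V_mat: "u \<in> carrier V \<Longrightarrow> x \<in> X \<Longrightarrow> u x \<in> carrier_mat (nr x) n"
  by (simp add: V_carrier M_carrier)

lemma V_dim [simp]:
  "u \<in> carrier V \<Longrightarrow> x \<in> X \<Longrightarrow> dim_row (u x) = nr x" "u \<in> carrier V \<Longrightarrow> x \<in> X \<Longrightarrow> dim_col (u x) = n"
  using V_mat by auto

lemma V_entry_0:
  "u \<in> carrier V \<Longrightarrow> x \<in> X \<Longrightarrow> s < nr x \<Longrightarrow> t < n \<Longrightarrow> s \<noteq> \<rho> x \<Longrightarrow> u x $$ (s, t) = 0"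
  by (auto simp: V_carrier M_carrier)

lemma V_entry: "u x $$ (\<rho> x, t) = coord u x t * Poly_Mapping.single (sh x) 1"
  by (simp add: coord_def)

lemma coord_supp:
  assumes "u \<in> carrier V" "x \<in> X" "t < n"
  shows "supp_ge (v x t) (coord u x t)"
proof -
  have "supp_ge (v x t + sh x) (u x $$ (\<rho> x, t))"
    using assms row[OF assms(2)] by (auto simp: V_carrier M_carrier)
  then show ?thesis unfolding coord_def by (rule supp_ge_times_single) simp
qed

lemma V_eqI:
  assumes "u \<in> carrier V" "w \<in> carrier V"
    and "\<And>x t. x \<in> X \<Longrightarrow> t < n \<Longrightarrow> coord u x t = coord w x t"
  shows "u = w"
proof (rule extensionalityI)
  show "u \<in> extensional X" "w \<in> extensional X" using assms by (auto simp: V_carrier)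
  fix x assume x: "x \<in> X"
  show "u x = w x"
  proof (rule eq_matI)
    fix s t assume "s < dim_row (w x)" "t < dim_col (w x)"
    then have st: "s < nr x" "t < n" using assms x by auto
    show "u x $$ (s, t) = w x $$ (s, t)"
      using V_entry_0[OF assms(1) x st] V_entry_0[OF assms(2) x st] assms(3)[OF x st(2)]
        V_entry[of u x t] V_entry[of w x t] by (cases "s = \<rho> x") auto
  qed (use assms x in auto)
qed

lemma from_coord_closed:
  assumes "\<And>x t. x \<in> X \<Longrightarrow> t < n \<Longrightarrow> supp_ge (v x t) (\<Phi> x t)"
  shows "from_coord \<Phi> \<in> carrier V"
  using assms by (auto simp: V_carrier M_carrier from_coord_def intro: supp_ge_times_single)

lemma coord_from_coord [simp]:
  "x \<in> X \<Longrightarrow> t < n \<Longrightarrow> coord (from_coord \<Phi>) x t = \<Phi> x t"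
  using row by (simp add: coord_def from_coord_def)

lemma V_carrierI:
  assumes "u \<in> extensional X" "\<And>x. x \<in> X \<Longrightarrow> u x \<in> carrier_mat (nr x) n"
    and "\<And>x s t. x \<in> X \<Longrightarrow> s < nr x \<Longrightarrow> t < n \<Longrightarrow> s \<noteq> \<rho> x \<Longrightarrow> u x $$ (s, t) = 0"
    and "\<And>x t. x \<in> X \<Longrightarrow> t < n \<Longrightarrow> supp_ge (v x t) (coord u x t)"
  shows "u \<in> carrier V"
proof -
  have "supp_ge (v x t + sh x) (u x $$ (\<rho> x, t))" if "x \<in> X" "t < n" for x t
    unfolding V_entry using assms(4)[OF that] by (rule supp_ge_times_single) simp
  then show ?thesis using assms by (auto simp: V_carrier M_carrier)
qed

lemma zero_closed: "\<zero>\<^bsub>V\<^esub> \<in> carrier V"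
  by (rule V_carrierI) (use row in \<open>auto simp: V_zero V_zero_ext coord_def\<close>)

lemma coord_zero [simp]: "x \<in> X \<Longrightarrow> t < n \<Longrightarrow> coord \<zero>\<^bsub>V\<^esub> x t = 0"
  using row by (simp add: coord_def V_zero)

lemma coord_add [simp]:
  "u \<in> carrier V \<Longrightarrow> w \<in> carrier V \<Longrightarrow> x \<in> X \<Longrightarrow> t < n \<Longrightarrow>
    coord (u \<oplus>\<^bsub>V\<^esub> w) x t = coord u x t + coord w x t"
  using row by (simp add: coord_def V_add distrib_right)

lemma add_closed:
  assumes "u \<in> carrier V" "w \<in> carrier V"
  shows "u \<oplus>\<^bsub>V\<^esub> w \<in> carrier V"
proof (rule V_carrierI)
  fix x t assume "x \<in> X" "t < n"
  then show "supp_ge (v x t) (coord (u \<oplus>\<^bsub>V\<^esub> w) x t)"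
    using assms by (simp add: coord_supp supp_ge_add)
next
  fix x assume "x \<in> X"
  then show "(u \<oplus>\<^bsub>V\<^esub> w) x \<in> carrier_mat (nr x) n"
    using assms V_mat by (auto simp: V_add)
qed (use assms in \<open>auto simp: V_add V_add_ext V_entry_0\<close>)

lemma coord_ract:
  assumes "u \<in> carrier V" "a \<in> carrier_mat n n" "x \<in> X" "t < n"
  shows "coord (ract V u a) x t = (\<Sum>l<n. coord u x l * a $$ (l, t))"
  unfolding coord_def V_ract[OF assms(3)]
    mat_mult_entry[OF V_mat[OF assms(1,3)] assms(2) row[OF assms(3)] assms(4)]
  by (simp add: sum_distrib_left sum_distrib_right ac_simps)

lemma ract_closed:
  assumes "u \<in> carrier V" "a \<in> carrier A"
  shows "ract V u a \<in> carrier V"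
proof (rule V_carrierI)
  have a: "a \<in> carrier_mat n n" using assms(2) by (simp add: tiled_order_carrier)
  fix x assume x: "x \<in> X"
  show "ract V u a x \<in> carrier_mat (nr x) n"
    using a V_mat[OF assms(1) x] by (simp add: V_ract x)
  show "ract V u a x $$ (s, t) = 0" if "s < nr x" "t < n" "s \<noteq> \<rho> x" for s t
    using mat_mult_entry[OF V_mat[OF assms(1) x] a that(1,2)] that V_entry_0[OF assms(1) x]
    by (simp add: V_ract x)
  show "supp_ge (v x t) (coord (ract V u a) x t)" if t: "t < n" for t
    unfolding coord_ract[OF assms(1) a x t]
    using assms x t lattice[OF x _ t]
    by (intro supp_ge_sum supp_ge_mult[OF coord_supp]) (auto simp: tiled_order_carrier)
qed (rule V_ract_ext)

lemma hcomp_iff: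
  "u \<in> hcomp V j \<longleftrightarrow> u \<in> carrier V \<and> (\<forall>x\<in>X. \<forall>t<n. homog j (coord u x t))"
proof (cases "u \<in> carrier V")
  case True
  have "homogeneous_mat (j + sh x) (u x) \<longleftrightarrow> (\<forall>t<n. homog j (coord u x t))" if x: "x \<in> X" for x
  proof
    assume h: "homogeneous_mat (j + sh x) (u x)"
    show "\<forall>t<n. homog j (coord u x t)"
    proof (intro allI impI)
      fix t assume "t < n"
      then have "homog (j + sh x) (u x $$ (\<rho> x, t))"
        using h row[OF x] True x by (simp add: homogeneous_mat_iff)
      then show "homog j (coord u x t)"
        unfolding coord_def by (rule homog_mult[OF _ homog_single]) simp
    qed
  next
    assume h: "\<forall>t<n. homog j (coord u x t)"
    show "homogeneous_mat (j + sh x) (u x)"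
      unfolding homogeneous_mat_iff
    proof (intro allI impI)
      fix s t assume "s < dim_row (u x)" "t < dim_col (u x)"
      then have st: "s < nr x" "t < n" using True x by auto
      show "homog (j + sh x) (u x $$ (s, t))"
      proof (cases "s = \<rho> x")
        case s: True
        show ?thesis unfolding s V_entry
          using h st by (intro homog_mult[OF _ homog_single]) auto
      qed (use V_entry_0[OF True x st] in simp)
    qed
  qed
  moreover have "u \<in> hcomp V j \<longleftrightarrow> (\<forall>x\<in>X. homogeneous_mat (j + sh x) (u x))"
    using True by (auto simp: V_def direct_sum_module_def M_hcomp PiE_def Pi_def)
  ultimately show ?thesis using True by simp
next
  case False
  then show ?thesis by (auto simp: V_def direct_sum_module_def M_hcomp PiE_def Pi_def)
qed

lemma hcomp_closed: "u \<in> hcomp V j \<Longrightarrow> u \<in> carrier V"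
  by (simp add: hcomp_iff)

lemma V_abelian_group: "abelian_group V"
proof (rule abelian_groupI)
  fix u assume u: "u \<in> carrier V"
  let ?w = "from_coord (\<lambda>x t. - coord u x t)"
  have w: "?w \<in> carrier V" using u by (intro from_coord_closed supp_ge_uminus coord_supp)
  have "?w \<oplus>\<^bsub>V\<^esub> u = \<zero>\<^bsub>V\<^esub>"
    by (rule V_eqI) (use u w in \<open>auto simp: add_closed zero_closed\<close>)
  then show "\<exists>y\<in>carrier V. y \<oplus>\<^bsub>V\<^esub> u = \<zero>\<^bsub>V\<^esub>" using w by blast
qed (auto intro!: V_eqI simp: add_closed zero_closed ac_simps)

lemma coord_finsum:
  assumes "finite S" "f \<in> S \<rightarrow> carrier V" "x \<in> X" "t < n"
  shows "coord (finsum V f S) x t = (\<Sum>s\<in>S. coord (f s) x t)"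
  using assms(1,2)
proof (induction S rule: finite_induct)
  interpret abelian_group V by (rule V_abelian_group)
  case empty
  then show ?case using assms by (simp add: finsum_empty)
next
  interpret abelian_group V by (rule V_abelian_group)
  case (insert s S)
  then show ?case using assms by (simp add: finsum_insert Pi_def)
qed

lemma V_right_module: "right_module A V"
proof -
  have "ract V u (a \<otimes>\<^bsub>A\<^esub> b) = ract V (ract V u a) b"
    if u: "u \<in> carrier V" and a: "a \<in> carrier A" and b: "b \<in> carrier A" for u a b
  proof (rule extensionalityI[OF V_ract_ext V_ract_ext])
    fix x assume x: "x \<in> X"
    show "ract V u (a \<otimes>\<^bsub>A\<^esub> b) x = ract V (ract V u a) b x"
      using V_mat[OF u x] a b assoc_mult_mat[of "u x" "nr x" n a n b n]
      by (simp add: V_ract x tiled_order_carrier)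
  qed
  moreover have "ract V (u \<oplus>\<^bsub>V\<^esub> w) a = ract V u a \<oplus>\<^bsub>V\<^esub> ract V w a"
    if u: "u \<in> carrier V" and w: "w \<in> carrier V" and a: "a \<in> carrier A" for u w a
  proof (rule extensionalityI[OF V_ract_ext V_add_ext])
    fix x assume x: "x \<in> X"
    show "ract V (u \<oplus>\<^bsub>V\<^esub> w) a x = (ract V u a \<oplus>\<^bsub>V\<^esub> ract V w a) x"
      using V_mat[OF u x] V_mat[OF w x] a add_mult_distrib_mat[of "u x" "nr x" n "w x" a n]
      by (simp add: V_ract V_add x tiled_order_carrier)
  qed
  moreover have "ract V u (a \<oplus>\<^bsub>A\<^esub> b) = ract V u a \<oplus>\<^bsub>V\<^esub> ract V u b"
    if u: "u \<in> carrier V" and a: "a \<in> carrier A" and b: "b \<in> carrier A" for u a b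
  proof (rule extensionalityI[OF V_ract_ext V_add_ext])
    fix x assume x: "x \<in> X"
    show "ract V u (a \<oplus>\<^bsub>A\<^esub> b) x = (ract V u a \<oplus>\<^bsub>V\<^esub> ract V u b) x"
      using V_mat[OF u x] a b mult_add_distrib_mat[of "u x" "nr x" n a n b]
      by (simp add: V_ract V_add x tiled_order_carrier)
  qed
  moreover have "ract V u \<one>\<^bsub>A\<^esub> = u" if u: "u \<in> carrier V" for u
  proof (rule extensionalityI[OF V_ract_ext])
    fix x assume x: "x \<in> X"
    show "ract V u \<one>\<^bsub>A\<^esub> x = u x" using V_mat[OF u x] by (simp add: V_ract x)
  qed (use u in \<open>simp add: V_carrier\<close>)
  ultimately show ?thesis
    unfolding right_module_def using V_abelian_group ract_closed by blast
qed

text \<open>The homogeneous components of an element are read off from the coefficients of its coordinates;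
  comparing coefficients also gives uniqueness.\<close>

lemma V_graded: "graded_right_module A V"
  unfolding graded_right_module_def
proof (intro conjI allI ballI)
  interpret abelian_group V by (rule V_abelian_group)
  show "right_module A V" by (rule V_right_module)
  show "additive_subgroup (hcomp V j) V" for j
  proof (rule additive_subgroup.intro, rule add.subgroupI)
    show "hcomp V j \<subseteq> carrier V" by (auto simp: hcomp_iff)
    have "\<zero>\<^bsub>V\<^esub> \<in> hcomp V j" using zero_closed by (simp add: hcomp_iff)
    then show "hcomp V j \<noteq> {}" by blast
    show "u \<oplus>\<^bsub>V\<^esub> w \<in> hcomp V j" if "u \<in> hcomp V j" "w \<in> hcomp V j" for u w
      using that by (auto simp: hcomp_iff add_closed homog_add)
    show "\<ominus>\<^bsub>V\<^esub> u \<in> hcomp V j" if u: "u \<in> hcomp V j" for u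
    proof -
      have uV: "u \<in> carrier V" using u by (rule hcomp_closed)
      have "coord (\<ominus>\<^bsub>V\<^esub> u) x t = - coord u x t" if "x \<in> X" "t < n" for x t
      proof -
        have "coord (u \<oplus>\<^bsub>V\<^esub> \<ominus>\<^bsub>V\<^esub> u) x t = 0" using that uV by (simp add: r_neg)
        then show ?thesis using that uV by (simp add: eq_neg_iff_add_eq_0 add.commute)
      qed
      then show ?thesis using u uV by (simp add: hcomp_iff homog_uminus)
    qed
  qed
  fix m assume m: "m \<in> carrier V"
  let ?K = "\<Union>x\<in>X. \<Union>t<n. Poly_Mapping.keys (coord m x t)"
  let ?c = "\<lambda>j. from_coord (\<lambda>x t. Poly_Mapping.single j (Poly_Mapping.lookup (coord m x t) j))"
  have c: "?c j \<in> hcomp V j" for j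
  proof -
    have "?c j \<in> carrier V"
      using supp_ge_lookup[OF coord_supp[OF m]] by (intro from_coord_closed) auto
    then show ?thesis by (simp add: hcomp_iff)
  qed
  have sub: "{j. ?c j \<noteq> \<zero>\<^bsub>V\<^esub>} \<subseteq> ?K"
  proof (rule subsetI, rule ccontr)
    fix j assume "j \<in> {j. ?c j \<noteq> \<zero>\<^bsub>V\<^esub>}" "j \<notin> ?K"
    moreover from this have "?c j = \<zero>\<^bsub>V\<^esub>"
      using hcomp_closed[OF c[of j]] by (intro V_eqI) (auto simp: zero_closed in_keys_iff)
    ultimately show False by simp
  qed
  have "finite ?K" using finite_index by auto
  then have fin: "finite {j. ?c j \<noteq> \<zero>\<^bsub>V\<^esub>}" using sub finite_subset by blast
  have lookup_sum_c: "Poly_Mapping.lookup (coord (finsum V c {n. c n \<noteq> \<zero>\<^bsub>V\<^esub>}) x t) j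
      = Poly_Mapping.lookup (coord (c j) x t) j"
    if "\<And>j. c j \<in> hcomp V j" "finite {n. c n \<noteq> \<zero>\<^bsub>V\<^esub>}" "x \<in> X" "t < n" for c x t j
  proof -
    have "Poly_Mapping.lookup (coord (c i) x t) j
        = (if i = j then Poly_Mapping.lookup (coord (c j) x t) j else 0)" for i
      using that(1)[of i] that(3,4) homog_lookup[of i "coord (c i) x t" j] by (auto simp: hcomp_iff)
    then have "Poly_Mapping.lookup (coord (finsum V c {n. c n \<noteq> \<zero>\<^bsub>V\<^esub>}) x t) j
        = (\<Sum>i\<in>{n. c n \<noteq> \<zero>\<^bsub>V\<^esub>}. if i = j then Poly_Mapping.lookup (coord (c j) x t) j else 0)"
      using that hcomp_closed[OF that(1)]
      by (subst coord_finsum) (auto simp: lookup_sum intro!: sum.cong)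
    then show ?thesis using that by (auto simp: sum.delta)
  qed
  show "\<exists>!c. (\<forall>n. c n \<in> hcomp V n) \<and> finite {n. c n \<noteq> \<zero>\<^bsub>V\<^esub>} \<and>
      m = finsum V c {n. c n \<noteq> \<zero>\<^bsub>V\<^esub>}"
  proof (rule ex1I[of _ ?c], intro conjI allI)
    show "?c j \<in> hcomp V j" for j by (rule c)
    show "finite {j. ?c j \<noteq> \<zero>\<^bsub>V\<^esub>}" by (rule fin)
    show "m = finsum V ?c {n. ?c n \<noteq> \<zero>\<^bsub>V\<^esub>}"
    proof (rule V_eqI[OF m])
      show "finsum V ?c {n. ?c n \<noteq> \<zero>\<^bsub>V\<^esub>} \<in> carrier V"
        using hcomp_closed[OF c] by (intro finsum_closed) auto
      show "coord m x t = coord (finsum V ?c {n. ?c n \<noteq> \<zero>\<^bsub>V\<^esub>}) x t" if "x \<in> X" "t < n" for x t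
        by (rule poly_mapping_eqI) (use that in \<open>simp add: lookup_sum_c[OF c fin]\<close>)
    qed
  next
    fix c assume h: "(\<forall>n. c n \<in> hcomp V n) \<and> finite {n. c n \<noteq> \<zero>\<^bsub>V\<^esub>} \<and>
      m = finsum V c {n. c n \<noteq> \<zero>\<^bsub>V\<^esub>}"
    show "c = ?c"
    proof (rule ext, rule V_eqI)
      fix j
      show "c j \<in> carrier V" "?c j \<in> carrier V" using h hcomp_closed c by auto
      fix x t assume xt: "x \<in> X" "t < n"
      have "homog j (coord (c j) x t)" using h xt by (auto simp: hcomp_iff)
      moreover have "Poly_Mapping.lookup (coord m x t) j = Poly_Mapping.lookup (coord (c j) x t) j"
        using lookup_sum_c[of c x t j] h xt by simp
      ultimately show "coord (c j) x t = coord (?c j) x t"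
        using xt by (simp add: homog_eq)
    qed
  qed
next
  fix i j m a assume m: "m \<in> hcomp V i" and a: "a \<in> hcomp A j"
  have "homog (i + j) (coord (ract V m a) x t)" if "x \<in> X" "t < n" for x t
  proof -
    have "a \<in> carrier_mat n n" using a by (simp add: tiled_order_carrier)
    then show ?thesis using m a that
      by (subst coord_ract) (auto simp: hcomp_iff homogeneous_mat_iff intro!: homog_sum homog_mult)
  qed
  then show "ract V m a \<in> hcomp V (i + j)"
    using m a by (auto simp: hcomp_iff intro: ract_closed)
qed

text \<open>The generator \<open>x\<^bsup>v x t\<^esup>\<close> in column \<open>t\<close> of the summand \<open>x\<close>, of degree \<open>v x t\<close>.\<close>

definition gen :: "'i \<Rightarrow> nat \<Rightarrow> 'i \<Rightarrow> 'k laurent mat" where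
  "gen x t = from_coord (\<lambda>y s. if y = x \<and> s = t then Poly_Mapping.single (v x t) 1 else 0)"

lemma gen_closed: "gen x t \<in> carrier V"
  unfolding gen_def by (rule from_coord_closed) auto

lemma coord_gen [simp]:
  "y \<in> X \<Longrightarrow> s < n \<Longrightarrow> coord (gen x t) y s = (if y = x \<and> s = t then Poly_Mapping.single (v x t) 1 else 0)"
  by (simp add: gen_def)

lemma gen_hcomp: "gen x t \<in> hcomp V (v x t)"
  using gen_closed by (auto simp: hcomp_iff)

lemma coord_ract_mat_unit:
  assumes "u \<in> carrier V" "x \<in> X" "t < n" "i < n"
  shows "coord (ract V u (mat_unit n i j f)) x t = (if t = j then coord u x i * f else 0)"
proof -
  have "coord (ract V u (mat_unit n i j f)) x t
      = (\<Sum>l<n. if l = i then (if t = j then coord u x i * f else 0) else 0)"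
    unfolding coord_ract[OF assms(1) mat_unit_mat assms(2,3)]
    using assms by (intro sum.cong) (auto simp: mat_unit_entry)
  then show ?thesis using assms(4) by simp
qed

text \<open>Since every element is a sum of multiples of the \<open>gen x t\<close>, whatever is compatible with addition and with
  the action of \<open>A\<close> only has to be checked on these generators.\<close>

lemma V_induct [consumes 1, case_names zero add gen]:
  assumes "u \<in> carrier V" "Q \<zero>\<^bsub>V\<^esub>"
    and add: "\<And>u w. u \<in> carrier V \<Longrightarrow> w \<in> carrier V \<Longrightarrow> Q u \<Longrightarrow> Q w \<Longrightarrow> Q (u \<oplus>\<^bsub>V\<^esub> w)"
    and gen: "\<And>x t a. x \<in> X \<Longrightarrow> t < n \<Longrightarrow> a \<in> carrier A \<Longrightarrow> Q (ract V (gen x t) a)"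
  shows "Q u"
proof -
  let ?u = "\<lambda>Y. from_coord (\<lambda>x t. if (x, t) \<in> Y then coord u x t else 0)"
  have cl: "?u Y \<in> carrier V" for Y
    using coord_supp[OF assms(1)] by (intro from_coord_closed) auto
  have "finite Y \<Longrightarrow> Y \<subseteq> X \<times> {..<n} \<Longrightarrow> Q (?u Y)" for Y
  proof (induction Y rule: finite_induct)
    case empty
    have "?u {} = \<zero>\<^bsub>V\<^esub>" using cl[of "{}"] by (intro V_eqI) (auto simp: zero_closed)
    then show ?case using assms(2) by simp
  next
    case (insert p Y)
    obtain x t where p: "p = (x, t)" by (cases p)
    have xt: "x \<in> X" "t < n" using insert.prems p by auto
    \<comment> \<open>the scalar that turns \<open>gen x t\<close> into the \<open>(x, t)\<close> part of \<open>u\<close>\<close>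
    let ?a = "mat_unit n t t (coord u x t * Poly_Mapping.single (- v x t) 1)"
    have a: "?a \<in> carrier A"
      unfolding mat_unit_carrier[OF xt(2) xt(2)] d_diag[OF xt(2)]
      by (rule supp_ge_times_single[OF coord_supp[OF assms(1) xt]]) simp
    have "?u (insert p Y) = ?u Y \<oplus>\<^bsub>V\<^esub> ract V (gen x t) ?a"
    proof (rule V_eqI[OF cl])
      show "?u Y \<oplus>\<^bsub>V\<^esub> ract V (gen x t) ?a \<in> carrier V"
        by (intro add_closed cl ract_closed gen_closed a)
      fix y s assume ys: "y \<in> X" "s < n"
      show "coord (?u (insert p Y)) y s = coord (?u Y \<oplus>\<^bsub>V\<^esub> ract V (gen x t) ?a) y s"
        using insert.hyps(2) ys xt cl ract_closed[OF gen_closed a, of x t]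
        by (auto simp: coord_ract_mat_unit gen_closed p mult_single ac_simps)
    qed
    then show ?case using insert a xt by (auto intro!: add cl ract_closed gen_closed gen)
  qed
  from this[of "X \<times> {..<n}"] have "Q (?u (X \<times> {..<n}))" using finite_index by simp
  moreover have "?u (X \<times> {..<n}) = u" using assms(1) by (intro V_eqI[OF cl]) auto
  ultimately show ?thesis by simp
qed

lemma V_fin_gen: "fin_gen A V"
proof -
  interpret abelian_group V by (rule V_abelian_group)
  let ?g = "\<lambda>(x, t). gen x t" and ?I = "X \<times> {..<n}"
  have inj: "inj_on ?g ?I"
  proof (rule inj_onI, clarify)
    fix x t y s assume h: "x \<in> X" "y \<in> X" "t < n" "s < n" "gen x t = gen y s"
    have "coord (gen y s) x t = Poly_Mapping.single (v x t) 1"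
      unfolding h(5)[symmetric] using h(1-4) by simp
    then show "x = y \<and> t = s" using h(1-4) by (auto simp: single_neq_0 split: if_splits)
  qed
  have "\<exists>a \<in> ?g ` ?I \<rightarrow> carrier A. m = finsum V (\<lambda>s. ract V s (a s)) (?g ` ?I)"
    if m: "m \<in> carrier V" for m
  proof -
    define b :: "'i \<times> nat \<Rightarrow> 'k laurent mat" where
      "b = (\<lambda>(x, t). mat_unit n t t (coord m x t * Poly_Mapping.single (- v x t) 1))"
    define a where "a = b \<circ> inv_into ?I ?g"
    have b: "b p \<in> carrier A" if "p \<in> ?I" for p
      using that supp_ge_times_single[OF coord_supp[OF m], of "fst p" "snd p"]
      by (auto simp: b_def mat_unit_carrier)
    have ab: "a (?g p) = b p" if "p \<in> ?I" for p
      using that inj by (simp add: a_def inv_into_f_f)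
    have "finsum V (\<lambda>s. ract V s (a s)) (?g ` ?I) = finsum V (\<lambda>p. ract V (?g p) (a (?g p))) ?I"
      using inj b ab by (intro finsum_reindex) (auto intro!: ract_closed gen_closed)
    also have "\<dots> = finsum V (\<lambda>p. ract V (?g p) (b p)) ?I"
      using b ab by (intro finsum_cong') (auto intro!: ract_closed gen_closed)
    also have "\<dots> = m"
    proof (rule V_eqI[OF _ m])
      have cl: "(\<lambda>p. ract V (?g p) (b p)) \<in> ?I \<rightarrow> carrier V"
        using b by (auto intro!: ract_closed gen_closed)
      then show "finsum V (\<lambda>p. ract V (?g p) (b p)) ?I \<in> carrier V" by (rule finsum_closed)
      fix y s assume ys: "y \<in> X" "s < n"
      have "coord (finsum V (\<lambda>p. ract V (?g p) (b p)) ?I) y s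
          = (\<Sum>p\<in>?I. coord (ract V (?g p) (b p)) y s)"
        using cl ys finite_index by (intro coord_finsum) auto
      also have "\<dots> = (\<Sum>p\<in>?I. if p = (y, s) then coord m y s else 0)"
        using ys by (intro sum.cong)
          (auto simp: b_def coord_ract_mat_unit gen_closed mult_single ac_simps split: if_splits)
      finally show "coord (finsum V (\<lambda>p. ract V (?g p) (b p)) ?I) y s = coord m y s"
        using ys finite_index by simp
    qed
    finally have "m = finsum V (\<lambda>s. ract V s (a s)) (?g ` ?I)" by simp
    moreover have "a \<in> ?g ` ?I \<rightarrow> carrier A" using ab b by auto
    ultimately show ?thesis by blast
  qed
  moreover have "finite (?g ` ?I)" "?g ` ?I \<subseteq> carrier V" using finite_index gen_closed by auto
  ultimately show ?thesis unfolding fin_gen_def by blast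
qed

end

context row_lattices
begin

lemma coord_ract_scalar:
  assumes "u \<in> carrier V" "x \<in> X" "t < n"
  shows "coord (ract V u (f \<cdot>\<^sub>m 1\<^sub>m n)) x t = coord u x t * f"
proof -
  have "coord (ract V u (f \<cdot>\<^sub>m 1\<^sub>m n)) x t = (\<Sum>l<n. if l = t then coord u x t * f else 0)"
    unfolding coord_ract[OF assms(1) smult_carrier_mat[OF one_carrier_mat] assms(2,3)]
    using assms by (intro sum.cong) auto
  then show ?thesis using assms by simp
qed

lemma V_restrict_right_module:
  "right_module poly_ring (restrict_scalars (\<lambda>r. r \<cdot>\<^sub>m 1\<^sub>m n) V)"
proof -
  have "abelian_group (restrict_scalars (\<lambda>r. r \<cdot>\<^sub>m 1\<^sub>m n) V)"
    by (rule abelian_group_cong[OF V_abelian_group]) (auto simp: restrict_scalars_def)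
  moreover have one: "1 \<cdot>\<^sub>m 1\<^sub>m n = (1\<^sub>m n :: 'k laurent mat)" by (intro eq_matI) auto
  moreover have cl: "f \<cdot>\<^sub>m 1\<^sub>m n \<in> carrier A" if "f \<in> carrier poly_ring" for f :: "'k laurent"
    using that smult_one_carrier[OF tiled] by (simp add: poly_ring_carrier)
  ultimately show ?thesis
    using V_right_module unfolding right_module_def
    by (auto simp: restrict_scalars_def smult_one_add smult_one_mult poly_ring_def smult_one_carrier[OF tiled] supp_ge_def)
qed

text \<open>Multiplying the coordinate \<open>(x, t)\<close> by \<open>x\<^bsup>- v x t\<^esup>\<close> identifies \<open>V\<close> with a free \<open>R\<close>-module of rank
  \<open>card (X \<times> {..<n})\<close>, with basis the elements \<open>gen x t\<close>.\<close>

lemma V_projective_over_poly_ring: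
  "fg_projective poly_ring (restrict_scalars (\<lambda>r. r \<cdot>\<^sub>m 1\<^sub>m n) V)"
proof -
  let ?I = "X \<times> {..<n}" and ?W = "restrict_scalars (\<lambda>r. r \<cdot>\<^sub>m 1\<^sub>m n) V"
  obtain \<beta> where \<beta>: "bij_betw \<beta> {0..<card ?I} ?I"
    using ex_bij_betw_nat_finite[of ?I] finite_index by auto
  define N where "N = card ?I"
  define \<gamma> where "\<gamma> = inv_into {..<N} \<beta>"
  have \<beta>: "bij_betw \<beta> {..<N} ?I" using \<beta> by (simp add: N_def atLeast0LessThan)
  have \<beta>I: "fst (\<beta> i) \<in> X" "snd (\<beta> i) < n" if "i < N" for i
    using bij_betwE[OF \<beta>] that by (metis lessThan_iff mem_Times_iff)+
  have \<gamma>: "\<gamma> (x, t) < N" "\<beta> (\<gamma> (x, t)) = (x, t)" if "x \<in> X" "t < n" for x t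
    using bij_betw_inv_into[OF \<beta>] bij_betw_inv_into_right[OF \<beta>, of "(x, t)"] that
    by (auto simp: \<gamma>_def bij_betw_def)
  let ?F = "direct_sum_module {..<N} (\<lambda>i. regular_module (poly_ring :: 'k laurent graded))"
  define \<iota> where "\<iota> = (\<lambda>u\<in>carrier V. \<lambda>i\<in>{..<N}.
    coord u (fst (\<beta> i)) (snd (\<beta> i)) * Poly_Mapping.single (- v (fst (\<beta> i)) (snd (\<beta> i))) 1)"
  define \<pi> where "\<pi> = (\<lambda>w\<in>carrier ?F. from_coord (\<lambda>x t. w (\<gamma> (x, t)) * Poly_Mapping.single (v x t) 1))"
  have W: "carrier ?W = carrier V" "add ?W = add V" "ract ?W u f = ract V u (f \<cdot>\<^sub>m 1\<^sub>m n)" for u f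
    by (simp_all add: restrict_scalars_def)
  have F: "w \<in> carrier ?F \<longleftrightarrow> w \<in> extensional {..<N} \<and> (\<forall>i<N. supp_ge 0 (w i))"
    "i < N \<Longrightarrow> (w \<oplus>\<^bsub>?F\<^esub> w') i = w i + w' i" "i < N \<Longrightarrow> ract ?F w f i = w i * f"
    "w \<oplus>\<^bsub>?F\<^esub> w' \<in> extensional {..<N}" "ract ?F w f \<in> extensional {..<N}" for w w' i f
    by (auto simp: direct_sum_module_def regular_module_def PiE_def Pi_def poly_ring_carrier)
      (auto simp: poly_ring_def)
  have F_add: "w \<oplus>\<^bsub>?F\<^esub> w' \<in> carrier ?F" if "w \<in> carrier ?F" "w' \<in> carrier ?F" for w w'
    using that unfolding F(1) by (auto simp: F intro: supp_ge_add)
  have F_ract: "ract ?F w f \<in> carrier ?F" if "w \<in> carrier ?F" "supp_ge 0 f" for w f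
    using that unfolding F(1) by (auto simp: F intro!: supp_ge_mult[of 0 _ 0])
  have cl: "f \<cdot>\<^sub>m 1\<^sub>m n \<in> carrier A" if "supp_ge 0 f" for f :: "'k laurent"
    using that by (rule smult_one_carrier[OF tiled])
  have \<iota>cl: "\<iota> u \<in> carrier ?F" if u: "u \<in> carrier V" for u
    unfolding F(1) using u
    by (auto simp: \<iota>_def \<beta>I intro!: supp_ge_times_single[OF coord_supp])
  have \<pi>cl: "\<pi> w \<in> carrier V" if "w \<in> carrier ?F" for w
    using that \<gamma> unfolding \<pi>_def
    by (auto simp: F(1) intro!: from_coord_closed supp_ge_times_single[of 0])
  have \<pi>coord: "coord (\<pi> w) x t = w (\<gamma> (x, t)) * Poly_Mapping.single (v x t) 1"
    if "w \<in> carrier ?F" "x \<in> X" "t < n" for w x t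
    using that by (simp add: \<pi>_def)
  have "\<iota> \<in> module_hom poly_ring ?W ?F"
    unfolding module_hom_def W
  proof (intro CollectI conjI ballI)
    show "\<iota> \<in> carrier V \<rightarrow>\<^sub>E carrier ?F" using \<iota>cl by (auto simp: \<iota>_def)
    show "\<iota> (u \<oplus>\<^bsub>V\<^esub> w) = \<iota> u \<oplus>\<^bsub>?F\<^esub> \<iota> w" if "u \<in> carrier V" "w \<in> carrier V" for u w
      by (rule extensionalityI[where A = "{..<N}"])
        (use that \<beta>I in \<open>auto simp: F \<iota>_def add_closed distrib_right\<close>)
    show "\<iota> (ract V u (f \<cdot>\<^sub>m 1\<^sub>m n)) = ract ?F (\<iota> u) f"
      if "u \<in> carrier V" "f \<in> carrier poly_ring" for u f
      by (rule extensionalityI[where A = "{..<N}"])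
        (use that \<beta>I cl in \<open>auto simp: F \<iota>_def ract_closed coord_ract_scalar poly_ring_carrier\<close>)
  qed
  moreover have "\<pi> \<in> module_hom poly_ring ?F ?W"
    unfolding module_hom_def W
  proof (intro CollectI conjI ballI)
    show "\<pi> \<in> carrier ?F \<rightarrow>\<^sub>E carrier V" using \<pi>cl by (auto simp: \<pi>_def)
    show "\<pi> (u \<oplus>\<^bsub>?F\<^esub> w) = \<pi> u \<oplus>\<^bsub>V\<^esub> \<pi> w" if "u \<in> carrier ?F" "w \<in> carrier ?F" for u w
      by (rule V_eqI)
        (use that \<gamma> in \<open>auto simp: \<pi>cl F_add add_closed \<pi>coord F(2-5) distrib_right\<close>)
    show "\<pi> (ract ?F u f) = ract V (\<pi> u) (f \<cdot>\<^sub>m 1\<^sub>m n)"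
      if "u \<in> carrier ?F" "f \<in> carrier poly_ring" for u f
      by (rule V_eqI)
        (use that \<gamma> cl in \<open>auto simp: \<pi>cl F_ract ract_closed \<pi>coord F(2-5) coord_ract_scalar poly_ring_carrier ac_simps\<close>)
  qed
  moreover have "compose (carrier ?W) \<pi> \<iota> = (\<lambda>m\<in>carrier ?W. m)"
  proof (rule extensionalityI[where A = "carrier V"])
    fix u assume u: "u \<in> carrier V"
    have "\<pi> (\<iota> u) = u"
    proof (rule V_eqI[OF \<pi>cl[OF \<iota>cl[OF u]] u])
      fix x t assume xt: "x \<in> X" "t < n"
      have "\<iota> u (\<gamma> (x, t)) = coord u x t * Poly_Mapping.single (- v x t) 1"
        using u \<gamma>[OF xt] by (simp add: \<iota>_def)
      then show "coord (\<pi> (\<iota> u)) x t = coord u x t"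
        using \<pi>coord[OF \<iota>cl[OF u] xt] by simp
    qed
    then show "compose (carrier ?W) \<pi> \<iota> u = (\<lambda>m\<in>carrier ?W. m) u"
      using u by (simp add: compose_def W)
  qed (auto simp: W compose_def)
  ultimately show ?thesis
    using V_restrict_right_module unfolding fg_projective_def Let_def by blast
qed

lemma V_CM: "CM_object n d V"
  using V_graded V_fin_gen V_projective_over_poly_ring by (simp add: CM_object_def)

lemma ract_zero: "a \<in> carrier A \<Longrightarrow> ract V \<zero>\<^bsub>V\<^esub> a = \<zero>\<^bsub>V\<^esub>"
  by (rule V_eqI) (auto simp: ract_closed zero_closed coord_ract tiled_order_carrier)

lemma zero_add_zero: "\<zero>\<^bsub>V\<^esub> \<oplus>\<^bsub>V\<^esub> \<zero>\<^bsub>V\<^esub> = \<zero>\<^bsub>V\<^esub>"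
  by (rule V_eqI) (auto simp: zero_closed add_closed)

lemma V_idem_zero:
  assumes "u \<in> carrier V" "u = u \<oplus>\<^bsub>V\<^esub> u"
  shows "u = \<zero>\<^bsub>V\<^esub>"
proof (rule V_eqI[OF assms(1) zero_closed])
  fix x t assume xt: "x \<in> X" "t < n"
  have "coord u x t = coord u x t + coord u x t"
    using assms(2) coord_add[OF assms(1) assms(1) xt] by simp
  then have "coord u x t = 0" by (simp only: add_cancel_right_right)
  then show "coord u x t = coord \<zero>\<^bsub>V\<^esub> x t" using xt by simp
qed

lemma End_zero:
  assumes "f \<in> module_hom A V V"
  shows "f \<zero>\<^bsub>V\<^esub> = \<zero>\<^bsub>V\<^esub>"
proof (rule V_idem_zero)
  show "f \<zero>\<^bsub>V\<^esub> \<in> carrier V" using assms zero_closed by (auto simp: module_hom_def)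
  note zero_add_zero
  then show "f \<zero>\<^bsub>V\<^esub> = f \<zero>\<^bsub>V\<^esub> \<oplus>\<^bsub>V\<^esub> f \<zero>\<^bsub>V\<^esub>"
    using assms zero_closed unfolding module_hom_def by (metis (mono_tags, lifting) mem_Collect_eq)
qed

lemma End_eqI:
  assumes f: "f \<in> module_hom A V V" and g: "g \<in> module_hom A V V"
    and gen: "\<And>x t. x \<in> X \<Longrightarrow> t < n \<Longrightarrow> f (gen x t) = g (gen x t)"
  shows "f = g"
proof (rule extensionalityI[where A = "carrier V"])
  show "f \<in> extensional (carrier V)" "g \<in> extensional (carrier V)"
    using f g by (auto simp: module_hom_def PiE_def)
  fix u assume "u \<in> carrier V"
  then show "f u = g u"
  proof (induction u rule: V_induct)
    case zero
    show ?case using End_zero[OF f] End_zero[OF g] by simp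
  next
    case (add u w)
    then show ?case using f g by (auto simp: module_hom_def)
  next
    case (gen x t a)
    then show ?case using f g assms(3)[OF gen(1,2)] gen_closed by (auto simp: module_hom_def)
  qed
qed

text \<open>The relation that links the generators of one summand: both sides are the monomial
  \<open>x\<^bsup>v x t + d t t'\<^esup>\<close> in column \<open>t'\<close>. Since \<open>V\<close> has no \<open>x\<close>-torsion, it forces a homomorphism to
  act in the same way on \<open>gen x t\<close> and on \<open>gen x t'\<close>.\<close>

lemma gen_mat_unit:
  assumes "x \<in> X" "t < n" "t' < n"
  shows "ract V (gen x t) (mat_unit n t t' (Poly_Mapping.single (d t t') 1))
    = ract V (gen x t') (mat_unit n t' t' (Poly_Mapping.single (v x t + d t t' - v x t') 1))"
proof (rule V_eqI)
  show "ract V (gen x t) (mat_unit n t t' (Poly_Mapping.single (d t t') 1)) \<in> carrier V"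
    using assms by (intro ract_closed gen_closed) (simp add: mat_unit_carrier)
  show "ract V (gen x t') (mat_unit n t' t' (Poly_Mapping.single (v x t + d t t' - v x t') 1)) \<in> carrier V"
    using assms lattice[OF assms] by (intro ract_closed gen_closed) (simp add: mat_unit_carrier)
qed (use assms in \<open>auto simp: coord_ract_mat_unit gen_closed mult_single\<close>)

lemma gen_idempotent:
  assumes "x \<in> X" "t < n"
  shows "ract V (gen x t) (mat_unit n t t 1) = gen x t"
  by (rule V_eqI)
    (use assms in \<open>auto simp: coord_ract_mat_unit gen_closed mat_unit_carrier intro!: ract_closed\<close>)

lemma mat_unit_in_A:
  assumes "x \<in> X" "t < n" "t' < n"
  shows "mat_unit n t t' (Poly_Mapping.single (d t t') 1) \<in> carrier A"
    "mat_unit n t' t' (Poly_Mapping.single (v x t + d t t' - v x t') 1) \<in> carrier A"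
    "mat_unit n t t 1 \<in> carrier A"
  using assms lattice[OF assms] by (simp_all add: mat_unit_carrier)

text \<open>A map of degree \<open>0\<close> from the summand \<open>x\<close> to the summand \<open>y\<close> is multiplication by a scalar \<open>c\<close>: since
  \<open>gen x t\<close> is fixed by the idempotent of column \<open>t\<close>, its image lies in column \<open>t\<close>, and it is homogeneous of degree
  \<open>v x t\<close>, hence a scalar multiple of one monomial; the scalar is independent of \<open>t\<close> by
  \<open>gen_mat_unit\<close>. If it is nonzero, this monomial lies in the target, so \<open>v y t \<le> v x t\<close>.\<close>

lemma End_gen:
  assumes f: "f \<in> graded_hom A V V" and x: "x \<in> X" and y: "y \<in> X"
  obtains c where "\<And>t s. t < n \<Longrightarrow> s < n \<Longrightarrow>
      coord (f (gen x t)) y s = (if s = t then Poly_Mapping.single (v x t) c else 0)"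
    and "\<And>t. t < n \<Longrightarrow> c \<noteq> 0 \<Longrightarrow> v y t \<le> v x t"
proof -
  have lin: "f (ract V u a) = ract V (f u) a" "f u \<in> carrier V" if "u \<in> carrier V" "a \<in> carrier A" for u a
    using f that by (auto simp: graded_hom_def module_hom_def)
  have cl: "f (gen x t) \<in> carrier V" if "t < n" for t
    using lin(2)[OF gen_closed mat_unit_in_A(3)[OF x that that]] .
  have hom: "homog (v x t) (coord (f (gen x t)) y s)" if "t < n" "s < n" for t s
    using f gen_hcomp[of x t] y that by (force simp: graded_hom_def hcomp_iff)
  have off: "coord (f (gen x t)) y s = 0" if "t < n" "s < n" "s \<noteq> t" for t s
  proof -
    have "f (gen x t) = ract V (f (gen x t)) (mat_unit n t t 1)"
      by (rule lin(1)[OF gen_closed mat_unit_in_A(3)[OF x that(1,1)], of x t, unfolded gen_idempotent[OF x that(1)]])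
    then show ?thesis
      using coord_ract_mat_unit[OF cl[OF that(1)] y that(2,1), of t 1] that(3) by simp
  qed
  define c where "c t = Poly_Mapping.lookup (coord (f (gen x t)) y t) (v x t)" for t
  have c: "coord (f (gen x t)) y t = Poly_Mapping.single (v x t) (c t)" if "t < n" for t
    using hom[OF that that] by (simp add: homog_eq c_def)
  have "c t = c 0" if t: "t < n" for t
  proof -
    have eq: "ract V (f (gen x 0)) (mat_unit n 0 t (Poly_Mapping.single (d 0 t) 1))
      = ract V (f (gen x t)) (mat_unit n t t (Poly_Mapping.single (v x 0 + d 0 t - v x t) 1))"
      using arg_cong[OF gen_mat_unit[OF x n_pos t], of f] lin(1)[OF gen_closed]
        mat_unit_in_A[OF x n_pos t] by simp
    have "coord (ract V (f (gen x 0)) (mat_unit n 0 t (Poly_Mapping.single (d 0 t) 1))) y t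
        = Poly_Mapping.single (v x 0 + d 0 t) (c 0)"
      using coord_ract_mat_unit[OF cl[OF n_pos] y t n_pos] c[OF n_pos] by (simp add: mult_single)
    moreover have "coord (ract V (f (gen x t)) (mat_unit n t t (Poly_Mapping.single (v x 0 + d 0 t - v x t) 1))) y t
        = Poly_Mapping.single (v x 0 + d 0 t) (c t)"
      using coord_ract_mat_unit[OF cl[OF t] y t t] c[OF t] by (simp add: mult_single)
    ultimately show ?thesis unfolding eq by (metis lookup_single_eq)
  qed
  moreover have "v y t \<le> v x t" if "t < n" "c t \<noteq> 0" for t
    using coord_supp[OF cl[OF that(1)] y that(1)] c[OF that(1)] that by simp
  ultimately show ?thesis using that[of "c 0"] c off by (metis (full_types))
qed

end

section \<open>Maps factoring through projectives\<close>

lemma graded_hom_compose: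
  assumes f: "f \<in> graded_hom A M N" and g: "g \<in> graded_hom A N L"
    and M: "\<And>n. hcomp M n \<subseteq> carrier M" "\<And>m a. m \<in> carrier M \<Longrightarrow> a \<in> carrier A \<Longrightarrow> ract M m a \<in> carrier M"
      "\<And>m m'. m \<in> carrier M \<Longrightarrow> m' \<in> carrier M \<Longrightarrow> m \<oplus>\<^bsub>M\<^esub> m' \<in> carrier M"
  shows "compose (carrier M) g f \<in> graded_hom A M L"
proof -
  have f1: "\<And>m. m \<in> carrier M \<Longrightarrow> f m \<in> carrier N" using f by (auto simp: graded_hom_def module_hom_def)
  have "compose (carrier M) g f \<in> carrier M \<rightarrow>\<^sub>E carrier L"
    using f1 g by (auto simp: compose_def graded_hom_def module_hom_def)
  moreover have "compose (carrier M) g f ` hcomp M j \<subseteq> hcomp L j" for j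
  proof
    fix z assume "z \<in> compose (carrier M) g f ` hcomp M j"
    then obtain u where u: "u \<in> hcomp M j" "z = g (f u)" using M(1) by (auto simp: compose_def)
    then have "f u \<in> hcomp N j" using f by (auto simp: graded_hom_def)
    then show "z \<in> hcomp L j" using g u by (auto simp: graded_hom_def)
  qed
  ultimately show ?thesis
    using f g f1 M(2,3) by (simp add: graded_hom_def module_hom_def compose_def)
qed

abbreviation graded_free :: "nat \<Rightarrow> (nat \<Rightarrow> nat \<Rightarrow> int) \<Rightarrow> nat \<Rightarrow> (nat \<Rightarrow> int) \<Rightarrow>
    ('k::field laurent mat, nat \<Rightarrow> 'k laurent mat) gmodule" where
  "graded_free n d r s \<equiv> direct_sum_module {..<r} (\<lambda>i. shift_module (s i) (regular_module (tiled_order n d)))"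

lemma graded_free_sel:
  "w \<in> carrier (graded_free n d r s) \<longleftrightarrow> w \<in> extensional {..<r} \<and> (\<forall>i<r. w i \<in> carrier (tiled_order n d))"
  "i < r \<Longrightarrow> (w \<oplus>\<^bsub>graded_free n d r s\<^esub> w') i = w i + w' i"
  "i < r \<Longrightarrow> ract (graded_free n d r s) w a i = w i * a"
  "w \<oplus>\<^bsub>graded_free n d r s\<^esub> w' \<in> extensional {..<r}"
  "ract (graded_free n d r s) w a \<in> extensional {..<r}"
  "w \<in> hcomp (graded_free n d r s) j \<longleftrightarrow> w \<in> carrier (graded_free n d r s) \<and> (\<forall>i<r. homogeneous_mat (j + s i) (w i))"
  by (auto simp: direct_sum_module_def regular_module_def shift_module_def PiE_def Pi_def)

text \<open>This applies to the image of \<open>0\<close> under an additive map with values in matrices.\<close>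

lemma zero_matI:
  fixes m :: "'a::comm_ring_1 mat"
  assumes "m \<in> carrier_mat n n" "m = m + m"
  shows "m = 0\<^sub>m n n"
proof (rule eq_matI)
  fix i j assume "i < dim_row (0\<^sub>m n n :: 'a mat)" "j < dim_col (0\<^sub>m n n :: 'a mat)"
  then have ij: "i < n" "j < n" by auto
  have "m $$ (i, j) = (m + m) $$ (i, j)" using assms(2) by simp
  then have "m $$ (i, j) = m $$ (i, j) + m $$ (i, j)" using assms(1) ij by simp
  then have "m $$ (i, j) = 0" by (simp only: add_cancel_right_right)
  then show "m $$ (i, j) = 0\<^sub>m n n $$ (i, j)" using ij by simp
qed (use assms in auto)

lemma zero_in_A: "0\<^sub>m n n \<in> carrier (tiled_order n d)"
  by (simp add: tiled_order_carrier)

context row_lattices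
begin

text \<open>The component of \<open>G (gen x t)\<close> in \<open>A(s l)\<close> lives in column \<open>t\<close>, and its entries are homogeneous of degree \<open>v x t + s l\<close>,
  which is at most \<open>v x t\<close>. In row \<open>k\<close> take the column \<open>\<tau>\<close> with \<open>v x \<tau> < d k \<tau>\<close>: the entry of
  \<open>G (gen x \<tau>)\<close> there is of too small a degree to be in \<open>A\<close>, so it is zero, and by \<open>gen_mat_unit\<close> the
  entries in row \<open>k\<close> vanish for all other generators of the same summand.\<close>

lemma hom_to_nonpos_shift:
  assumes G: "G \<in> graded_hom A V (graded_free n d r s)"
    and obstruct: "\<And>k. k < n \<Longrightarrow> \<exists>\<tau><n. \<forall>x\<in>X. v x \<tau> < d k \<tau>"
    and l: "l < r" "s l \<le> 0" and u: "u \<in> carrier V"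
  shows "G u l = 0\<^sub>m n n"
proof -
  have G_cl: "G u \<in> carrier (graded_free n d r s)" if "u \<in> carrier V" for u
    using G that by (auto simp: graded_hom_def module_hom_def)
  have G_mat: "G u l \<in> carrier_mat n n" if "u \<in> carrier V" for u
    using G_cl[OF that] l unfolding graded_free_sel(1) by (auto simp: tiled_order_carrier)
  have G_add: "G (u \<oplus>\<^bsub>V\<^esub> w) l = G u l + G w l" if "u \<in> carrier V" "w \<in> carrier V" for u w
    using G that graded_free_sel(2)[OF l(1)] by (auto simp: graded_hom_def module_hom_def)
  have G_ract: "G (ract V u a) l = G u l * a" if "u \<in> carrier V" "a \<in> carrier A" for u a
    using G that graded_free_sel(3)[OF l(1)] by (auto simp: graded_hom_def module_hom_def)
  have entry_hom: "homog (v x t + s l) (G (gen x t) l $$ (k, j))" if "k < n" "j < n" for x t k j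
  proof -
    have "G (gen x t) \<in> hcomp (graded_free n d r s) (v x t)"
      using G gen_hcomp[of x t] by (auto simp: graded_hom_def)
    then have "homogeneous_mat (v x t + s l) (G (gen x t) l)"
      using l unfolding graded_free_sel(6) by blast
    then show ?thesis using that G_mat[OF gen_closed, of x t] by (auto simp: homogeneous_mat_iff)
  qed
  have entry_supp: "supp_ge (d k j) (G (gen x t) l $$ (k, j))" if "k < n" "j < n" for x t k j
    using G_cl[OF gen_closed, of x t] l that unfolding graded_free_sel(1) by (auto simp: tiled_order_carrier)
  have diag: "G (gen x t) l $$ (k, t) = 0" if x: "x \<in> X" and t: "t < n" and k: "k < n" for x t k
  proof -
    obtain \<tau> where \<tau>: "\<tau> < n" "v x \<tau> < d k \<tau>" using obstruct[OF k] x by blast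
    have z: "G (gen x \<tau>) l $$ (k, \<tau>) = 0"
      by (rule homog_supp_ge_zero[OF entry_hom[OF k \<tau>(1)] entry_supp[OF k \<tau>(1)]]) (use \<tau> l in simp)
    let ?a = "mat_unit n t \<tau> (Poly_Mapping.single (d t \<tau>) 1)"
    let ?b = "mat_unit n \<tau> \<tau> (Poly_Mapping.single (v x t + d t \<tau> - v x \<tau>) 1)"
    have "G (gen x t) l * ?a = G (gen x \<tau>) l * ?b"
      using arg_cong[OF gen_mat_unit[OF x t \<tau>(1)], of "\<lambda>u. G u l"] mat_unit_in_A[OF x t \<tau>(1)]
      by (simp add: G_ract gen_closed)
    then have "(G (gen x t) l * ?a) $$ (k, \<tau>) = (G (gen x \<tau>) l * ?b) $$ (k, \<tau>)" by simp
    then have "G (gen x t) l $$ (k, t) * Poly_Mapping.single (d t \<tau>) 1 = 0"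
      using z t k \<tau> times_mat_unit_entry[OF G_mat[OF gen_closed], of _ k \<tau>] by simp
    then show ?thesis by (metis mult_zero_left single_cancel(1))
  qed
  have gen: "G (gen x t) l = 0\<^sub>m n n" if x: "x \<in> X" and t: "t < n" for x t
  proof (rule eq_matI)
    fix k j assume "k < dim_row (0\<^sub>m n n :: 'k laurent mat)" "j < dim_col (0\<^sub>m n n :: 'k laurent mat)"
    then have kj: "k < n" "j < n" by auto
    have "G (gen x t) l = G (gen x t) l * mat_unit n t t 1"
      by (rule G_ract[OF gen_closed mat_unit_in_A(3)[OF x t t], of x t, unfolded gen_idempotent[OF x t]])
    then have "G (gen x t) l $$ (k, j) = (if j = t then G (gen x t) l $$ (k, t) * 1 else 0)"
      using times_mat_unit_entry[OF G_mat[OF gen_closed] t kj, of x t t 1] by simp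
    then show "G (gen x t) l $$ (k, j) = 0\<^sub>m n n $$ (k, j)" using diag[OF x t kj(1)] kj by simp
  qed (use G_mat[OF gen_closed, of x t] in auto)
  show ?thesis using u
  proof (induction u rule: V_induct)
    case zero
    have "\<zero>\<^bsub>V\<^esub> \<oplus>\<^bsub>V\<^esub> \<zero>\<^bsub>V\<^esub> = \<zero>\<^bsub>V\<^esub>" by (rule zero_add_zero)
    then show ?case using G_add[OF zero_closed zero_closed] by (intro zero_matI G_mat zero_closed) simp
  next
    case (add u w)
    then show ?case by (simp add: G_add)
  next
    case (gen x t a)
    then show ?case using \<open>\<And>x t. x \<in> X \<Longrightarrow> t < n \<Longrightarrow> G (gen x t) l = 0\<^sub>m n n\<close>[OF gen(1,2)]
        left_mult_zero_mat[of a n n n] by (simp add: G_ract gen_closed tiled_order_carrier)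
  qed
qed

text \<open>The basis vector of a summand \<open>A(s l)\<close> with \<open>s l > 0\<close> has degree \<open>- s l < 0\<close>, and \<open>V\<close> has no nonzero
  elements of negative degree.\<close>

lemma hom_from_pos_shift:
  assumes H: "H \<in> graded_hom A (graded_free n d r s) V"
    and nonneg: "\<And>x t. x \<in> X \<Longrightarrow> t < n \<Longrightarrow> 0 \<le> v x t"
    and w: "w \<in> carrier (graded_free n d r s)" "\<And>l. l < r \<Longrightarrow> s l \<le> 0 \<Longrightarrow> w l = 0\<^sub>m n n"
  shows "H w = \<zero>\<^bsub>V\<^esub>"
proof -
  let ?F = "graded_free n d r s :: ('k laurent mat, nat \<Rightarrow> 'k laurent mat) gmodule"
  have H_cl: "H u \<in> carrier V" if "u \<in> carrier ?F" for u
    using H that by (auto simp: graded_hom_def module_hom_def)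
  have H_add: "H (u \<oplus>\<^bsub>?F\<^esub> w) = H u \<oplus>\<^bsub>V\<^esub> H w" if "u \<in> carrier ?F" "w \<in> carrier ?F" for u w
    using H that by (auto simp: graded_hom_def module_hom_def)
  have H_ract: "H (ract ?F u a) = ract V (H u) a" if "u \<in> carrier ?F" "a \<in> carrier A" for u a
    using H that by (auto simp: graded_hom_def module_hom_def)
  let ?w = "\<lambda>Y. (\<lambda>l\<in>{..<r}. if l \<in> Y then w l else 0\<^sub>m n n)"
  let ?e = "\<lambda>l. (\<lambda>i\<in>{..<r}. if i = l then 1\<^sub>m n else 0\<^sub>m n n)"
  have w_A: "w l \<in> carrier A" if "l < r" for l
    using w(1) that unfolding graded_free_sel(1) by blast
  have w_cl: "?w Y \<in> carrier ?F" for Y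
    unfolding graded_free_sel(1) using w_A zero_in_A by auto
  have e_cl: "?e l \<in> carrier ?F" for l
    unfolding graded_free_sel(1) using zero_in_A tiled_order_one_closed[OF tiled] by auto
  have e_hcomp: "?e l \<in> hcomp ?F (- s l)" for l
    unfolding graded_free_sel(6) using e_cl[of l]
    by (auto simp: homogeneous_mat_iff one_mat_def homog_def intro: exI[of _ 0] exI[of _ 1])
  have He: "H (?e l) = \<zero>\<^bsub>V\<^esub>" if l: "l < r" "0 < s l" for l
  proof (rule V_eqI[OF H_cl[OF e_cl] zero_closed])
    fix x t assume xt: "x \<in> X" "t < n"
    have "H (?e l) \<in> hcomp V (- s l)" using H e_hcomp[of l] by (auto simp: graded_hom_def)
    then have "homog (- s l) (coord (H (?e l)) x t)" using xt by (simp add: hcomp_iff)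
    then have "coord (H (?e l)) x t = 0"
      using coord_supp[OF H_cl[OF e_cl] xt] by (rule homog_supp_ge_zero) (use nonneg[OF xt] l in simp)
    then show "coord (H (?e l)) x t = coord \<zero>\<^bsub>V\<^esub> x t" using xt by simp
  qed
  have F_eqI: "u = u'" if "u \<in> carrier ?F" "u' \<in> carrier ?F" "\<And>i. i < r \<Longrightarrow> u i = u' i" for u u'
    using that unfolding graded_free_sel(1) by (intro extensionalityI[of u "{..<r}" u']) auto
  have F_add: "u \<oplus>\<^bsub>?F\<^esub> u' \<in> carrier ?F" if "u \<in> carrier ?F" "u' \<in> carrier ?F" for u u'
    using that unfolding graded_free_sel(1) by (auto simp: graded_free_sel intro: tiled_order_add_closed)
  have F_ract: "ract ?F u a \<in> carrier ?F" if "u \<in> carrier ?F" "a \<in> carrier A" for u a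
    using that unfolding graded_free_sel(1) by (auto simp: graded_free_sel intro: tiled_order_mult_closed[OF tiled])
  have "finite Y \<Longrightarrow> Y \<subseteq> {l. l < r \<and> 0 < s l} \<Longrightarrow> H (?w Y) = \<zero>\<^bsub>V\<^esub>" for Y
  proof (induction Y rule: finite_induct)
    case empty
    have eq: "?w {} \<oplus>\<^bsub>?F\<^esub> ?w {} = ?w {}"
      by (rule F_eqI[OF F_add[OF w_cl w_cl] w_cl]) (auto simp: graded_free_sel(2))
    show ?case
      by (rule V_idem_zero[OF H_cl[OF w_cl] H_add[OF w_cl w_cl, of "{}" "{}", unfolded eq]])
  next
    case (insert l Y)
    then have l: "l < r" "0 < s l" by auto
    have IH: "H (?w Y) = \<zero>\<^bsub>V\<^esub>" by (rule insert.IH) (use insert.prems in auto)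
    have "?w (insert l Y) = ?w Y \<oplus>\<^bsub>?F\<^esub> ract ?F (?e l) (w l)"
    proof (rule F_eqI[OF w_cl F_add[OF w_cl F_ract[OF e_cl w_A[OF l(1)]]]])
      fix i assume i: "i < r"
      then show "?w (insert l Y) i = (?w Y \<oplus>\<^bsub>?F\<^esub> ract ?F (?e l) (w l)) i"
        using insert.hyps(2) w_A[OF i] w_A[OF l(1)]
        by (auto simp: graded_free_sel(2,3) tiled_order_carrier)
    qed
    then have "H (?w (insert l Y)) = H (?w Y) \<oplus>\<^bsub>V\<^esub> ract V (H (?e l)) (w l)"
      using H_add[OF w_cl F_ract[OF e_cl w_A[OF l(1)]]] H_ract[OF e_cl w_A[OF l(1)]] by simp
    also have "\<dots> = \<zero>\<^bsub>V\<^esub> \<oplus>\<^bsub>V\<^esub> \<zero>\<^bsub>V\<^esub>"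
      unfolding IH He[OF l] ract_zero[OF w_A[OF l(1)]] ..
    also have "\<dots> = \<zero>\<^bsub>V\<^esub>" by (rule zero_add_zero)
    finally show ?case .
  qed
  from this[of "{l. l < r \<and> 0 < s l}"] have "H (?w {l. l < r \<and> 0 < s l}) = \<zero>\<^bsub>V\<^esub>" by simp
  moreover have "?w {l. l < r \<and> 0 < s l} = w"
    by (rule F_eqI[OF w_cl w(1)]) (use w(2) in \<open>auto simp: not_less\<close>)
  ultimately show ?thesis by simp
qed

text \<open>A graded projective is a retract of a graded free module, so the given map is a composite
  \<open>V \<rightarrow> F \<rightarrow> V\<close> with \<open>F\<close> graded free. The first map hits only the summands \<open>A(s)\<close> with \<open>s > 0\<close>, and the second
  one kills them.\<close>

lemma factors_through_projective_zero:
  assumes nonneg: "\<And>x t. x \<in> X \<Longrightarrow> t < n \<Longrightarrow> 0 \<le> v x t"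
    and obstruct: "\<And>k. k < n \<Longrightarrow> \<exists>\<tau><n. \<forall>x\<in>X. v x \<tau> < d k \<tau>"
    and f: "factors_through_projective A V V f"
  shows "f = (\<lambda>u\<in>carrier V. \<zero>\<^bsub>V\<^esub>)"
proof -
  from f obtain P :: "('k laurent mat, nat \<Rightarrow> 'k laurent mat) gmodule" and g h
    where P: "graded_projective A P" and g: "g \<in> graded_hom A V P" and h: "h \<in> graded_hom A P V"
      and fgh: "f = compose (carrier V) h g"
    unfolding factors_through_projective_def by blast
  from P obtain r s \<iota> \<pi> where \<iota>: "\<iota> \<in> graded_hom A P (graded_free n d r s)"
    and \<pi>: "\<pi> \<in> graded_hom A (graded_free n d r s) P"
    and \<pi>\<iota>: "compose (carrier P) \<pi> \<iota> = (\<lambda>m\<in>carrier P. m)"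
    unfolding graded_projective_def Let_def by blast
  let ?F = "graded_free n d r s :: ('k laurent mat, nat \<Rightarrow> 'k laurent mat) gmodule"
  let ?G = "compose (carrier V) \<iota> g" and ?H = "compose (carrier ?F) h \<pi>"
  have G: "?G \<in> graded_hom A V ?F"
    by (rule graded_hom_compose[OF g \<iota>]) (auto simp: hcomp_iff ract_closed add_closed)
  have H: "?H \<in> graded_hom A ?F V"
  proof (rule graded_hom_compose[OF \<pi> h])
    show "hcomp ?F j \<subseteq> carrier ?F" for j unfolding graded_free_sel(6) subset_iff by blast
    show "u \<oplus>\<^bsub>?F\<^esub> u' \<in> carrier ?F" if "u \<in> carrier ?F" "u' \<in> carrier ?F" for u u'
      using that unfolding graded_free_sel(1) by (auto simp: graded_free_sel intro: tiled_order_add_closed)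
    show "ract ?F u a \<in> carrier ?F" if "u \<in> carrier ?F" "a \<in> carrier A" for u a
      using that unfolding graded_free_sel(1) by (auto simp: graded_free_sel intro: tiled_order_mult_closed[OF tiled])
  qed
  have "f u = \<zero>\<^bsub>V\<^esub>" if u: "u \<in> carrier V" for u
  proof -
    have gu: "g u \<in> carrier P" using g u by (auto simp: graded_hom_def module_hom_def)
    then have "\<iota> (g u) \<in> carrier ?F" using \<iota> by (auto simp: graded_hom_def module_hom_def)
    moreover have "\<pi> (\<iota> (g u)) = g u" using fun_cong[OF \<pi>\<iota>, of "g u"] gu by (simp add: compose_def)
    ultimately have "f u = ?H (?G u)" and Gu: "?G u \<in> carrier ?F"
      using u fgh by (simp_all add: compose_def)
    moreover have "?H (?G u) = \<zero>\<^bsub>V\<^esub>"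
      by (rule hom_from_pos_shift[OF H nonneg Gu hom_to_nonpos_shift[OF G obstruct]]) (use u in auto)
    ultimately show ?thesis by simp
  qed
  then show ?thesis using fgh by (auto simp: compose_def fun_eq_iff)
qed

text \<open>The ideal that is factored out has to contain the zero map; the zero module is a suitable
  projective.\<close>

lemma zero_factors_through_projective:
  "factors_through_projective A V V (\<lambda>u\<in>carrier V. \<zero>\<^bsub>V\<^esub>)"
proof -
  define Z :: "('k laurent mat, nat \<Rightarrow> 'k laurent mat) gmodule" where "Z = graded_free n d 0 (\<lambda>_. 0)"
  let ?o = "(\<lambda>_. undefined) :: nat \<Rightarrow> 'k laurent mat"
  have Z: "carrier Z = {?o}" "\<zero>\<^bsub>Z\<^esub> = ?o" "u \<oplus>\<^bsub>Z\<^esub> w = ?o" "ract Z u a = ?o" "hcomp Z j = {?o}" for u w a j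
    by (auto simp: Z_def direct_sum_module_def restrict_def)
  have ab: "abelian_group Z" by (rule abelian_groupI) (auto simp: Z)
  then interpret Z: abelian_group Z .
  have grp: "additive_subgroup (hcomp Z j) Z" for j
  proof (rule additive_subgroup.intro, rule Z.add.subgroupI)
    show "\<ominus>\<^bsub>Z\<^esub> u \<in> hcomp Z j" if "u \<in> hcomp Z j" for u
      using Z.a_inv_closed[of u] that unfolding Z .
  qed (simp_all add: Z)
  have dec: "\<exists>!c. (\<forall>n. c n \<in> hcomp Z n) \<and> finite {n. c n \<noteq> \<zero>\<^bsub>Z\<^esub>} \<and> m = finsum Z c {n. c n \<noteq> \<zero>\<^bsub>Z\<^esub>}"
    if "m \<in> carrier Z" for m
  proof (rule ex1I[of _ "\<lambda>_. ?o"])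
    show "(\<forall>n. ?o \<in> hcomp Z n) \<and> finite {n::int. ?o \<noteq> \<zero>\<^bsub>Z\<^esub>} \<and> m = finsum Z (\<lambda>_. ?o) {n. ?o \<noteq> \<zero>\<^bsub>Z\<^esub>}"
      using that Z.finsum_empty[of "\<lambda>_. ?o"] by (simp add: Z)
  qed (simp add: Z fun_eq_iff)
  have gr: "graded_right_module A Z"
    unfolding graded_right_module_def right_module_def
    by (intro conjI allI ballI ab grp dec) (simp_all add: Z)
  let ?id = "\<lambda>m\<in>carrier Z. m"
  have id: "?id \<in> graded_hom A Z Z" "compose (carrier Z) ?id ?id = ?id"
    by (auto simp: graded_hom_def module_hom_def Z compose_def)
  have "graded_projective A Z"
    unfolding graded_projective_def Let_def
    by (intro conjI gr exI[of _ 0] exI[of _ "\<lambda>_. 0"], fold Z_def, intro bexI[of _ ?id] id)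
  moreover have "(\<lambda>u\<in>carrier V. ?o) \<in> graded_hom A V Z"
    by (auto simp: graded_hom_def module_hom_def Z add_closed ract_closed hcomp_closed)
  moreover have "(\<lambda>u\<in>carrier Z. \<zero>\<^bsub>V\<^esub>) \<in> graded_hom A Z V"
  proof -
    have "\<zero>\<^bsub>V\<^esub> \<oplus>\<^bsub>V\<^esub> \<zero>\<^bsub>V\<^esub> = \<zero>\<^bsub>V\<^esub>" by (rule zero_add_zero)
    then show ?thesis
      by (auto simp: graded_hom_def module_hom_def Z zero_closed ract_zero hcomp_iff)
  qed
  moreover have "(\<lambda>u\<in>carrier V. \<zero>\<^bsub>V\<^esub>) = compose (carrier V) (\<lambda>u\<in>carrier Z. \<zero>\<^bsub>V\<^esub>) (\<lambda>u\<in>carrier V. ?o)"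
    by (auto simp: compose_def Z)
  ultimately show ?thesis unfolding factors_through_projective_def by blast
qed

end

section \<open>Endomorphisms of a direct sum of row lattices\<close>

text \<open>The cosets of the zero ideal are singletons, so \<open>\<Psi>\<close> itself gives the isomorphism; the algebra axioms of \<open>E\<close>
  come from \<open>F\<close> through \<open>\<Psi>\<close>.\<close>

lemma algebra_isomorphic_quotient_by_zero:
  assumes I: "I = {\<zero>\<^bsub>E\<^esub>}" and zero_add: "\<And>x. x \<in> carrier E \<Longrightarrow> \<zero>\<^bsub>E\<^esub> \<oplus>\<^bsub>E\<^esub> x = x"
    and bij: "bij_betw \<Psi> (carrier F) (carrier E)"
    and add: "\<And>f g. f \<in> carrier F \<Longrightarrow> g \<in> carrier F \<Longrightarrow> f \<oplus>\<^bsub>F\<^esub> g \<in> carrier F \<and> \<Psi> (f \<oplus>\<^bsub>F\<^esub> g) = \<Psi> f \<oplus>\<^bsub>E\<^esub> \<Psi> g"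
    and mult: "\<And>f g. f \<in> carrier F \<Longrightarrow> g \<in> carrier F \<Longrightarrow> f \<otimes>\<^bsub>F\<^esub> g \<in> carrier F \<and> \<Psi> (f \<otimes>\<^bsub>F\<^esub> g) = \<Psi> f \<otimes>\<^bsub>E\<^esub> \<Psi> g"
    and one: "\<one>\<^bsub>F\<^esub> \<in> carrier F" "\<Psi> \<one>\<^bsub>F\<^esub> = \<one>\<^bsub>E\<^esub>"
    and smult: "\<And>c f. f \<in> carrier F \<Longrightarrow> c \<odot>\<^bsub>F\<^esub> f \<in> carrier F \<and> \<Psi> (c \<odot>\<^bsub>F\<^esub> f) = c \<odot>\<^bsub>E\<^esub> \<Psi> f"
  shows "algebra_isomorphic (quotient_algebra E I) F"
proof -
  let ?Q = "quotient_algebra E I"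
  define h where "h S = the_inv_into (carrier F) \<Psi> (the_elem S)" for S
  have inj: "inj_on \<Psi> (carrier F)" using bij by (simp add: bij_betw_def)
  have cl: "\<Psi> f \<in> carrier E" if "f \<in> carrier F" for f using bij that by (auto simp: bij_betw_def)
  have F_cl: "f \<oplus>\<^bsub>F\<^esub> g \<in> carrier F" "f \<otimes>\<^bsub>F\<^esub> g \<in> carrier F" "c \<odot>\<^bsub>F\<^esub> f \<in> carrier F" if "f \<in> carrier F" "g \<in> carrier F" for f g c
    using add mult smult that by blast+
  have coset: "I +>\<^bsub>E\<^esub> x = {x}" if "x \<in> carrier E" for x
    using that by (simp add: I a_r_coset_def' zero_add)
  have car: "carrier ?Q = (\<lambda>f. {\<Psi> f}) ` carrier F"
  proof -
    have "carrier ?Q = (\<lambda>x. {x}) ` carrier E"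
      using coset by (auto simp: quotient_algebra_def FactRing_def A_RCOSETS_def')
    also have "carrier E = \<Psi> ` carrier F" using bij by (simp add: bij_betw_def)
    finally show ?thesis by (simp add: image_image)
  qed
  have h: "h {\<Psi> f} = f" if "f \<in> carrier F" for f
    using inj that by (simp add: h_def the_inv_into_f_f)
  have Q_mult: "{\<Psi> f} \<otimes>\<^bsub>?Q\<^esub> {\<Psi> g} = {\<Psi> (f \<otimes>\<^bsub>F\<^esub> g)}" if "f \<in> carrier F" "g \<in> carrier F" for f g
    using that mult[OF that] cl coset[OF cl, of "f \<otimes>\<^bsub>F\<^esub> g"]
    by (simp add: quotient_algebra_def FactRing_def rcoset_mult_def)
  have Q_add: "{\<Psi> f} \<oplus>\<^bsub>?Q\<^esub> {\<Psi> g} = {\<Psi> (f \<oplus>\<^bsub>F\<^esub> g)}" if "f \<in> carrier F" "g \<in> carrier F" for f g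
    using that add[OF that] by (simp add: quotient_algebra_def FactRing_def set_add_def')
  have Q_one: "\<one>\<^bsub>?Q\<^esub> = {\<Psi> \<one>\<^bsub>F\<^esub>}"
    using one coset[OF cl[OF one(1)]] by (simp add: quotient_algebra_def FactRing_def)
  have Q_smult: "c \<odot>\<^bsub>?Q\<^esub> {\<Psi> f} = {\<Psi> (c \<odot>\<^bsub>F\<^esub> f)}" if "f \<in> carrier F" for c f
    using that smult[OF that, of c] coset[OF cl, of "c \<odot>\<^bsub>F\<^esub> f"] by (simp add: quotient_algebra_def)
  have "bij_betw h (carrier ?Q) (carrier F)"
    by (rule bij_betwI[where g = "\<lambda>f. {\<Psi> f}"]) (auto simp: car h)
  moreover have "h \<in> Ring.ring_hom ?Q F"
    unfolding Ring.ring_hom_def using F_cl one(1) by (auto simp: car h Q_mult Q_add Q_one)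
  ultimately have "h \<in> ring_iso ?Q F" by (simp add: ring_iso_def)
  moreover have "\<forall>c. \<forall>a\<in>carrier ?Q. h (c \<odot>\<^bsub>?Q\<^esub> a) = c \<odot>\<^bsub>F\<^esub> h a"
    using F_cl by (auto simp: car h Q_smult)
  ultimately show ?thesis unfolding algebra_isomorphic_def by blast
qed

text \<open>The order is reversed: a larger element of \<open>P\<close> belongs to smaller exponents, that is, to a larger
  lattice. This fits the convention for \<open>kP\<close>, where \<open>(y, x)\<close> with \<open>x \<le> y\<close> is an arrow from \<open>x\<close> to \<open>y\<close>.\<close>

locale poset_lattices = row_lattices n d X nr \<rho> sh v M
  for n d and X :: "'i set" and nr \<rho> sh v and M :: "'i \<Rightarrow> ('k::field laurent mat, 'k laurent mat) gmodule" +
  fixes P :: "'p set" and r :: "'p rel" and \<eta> :: "'i \<Rightarrow> 'p"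
  assumes order: "partial_order_on P r"
    and \<eta>_bij: "bij_betw \<eta> X P"
    and \<eta>_order: "\<And>x y. x \<in> X \<Longrightarrow> y \<in> X \<Longrightarrow> (\<eta> x, \<eta> y) \<in> r \<longleftrightarrow> (\<forall>t<n. v y t \<le> v x t)"
begin

abbreviation Inc :: "('k, 'p \<times> 'p \<Rightarrow> 'k) module" where "Inc \<equiv> incidence_algebra P r"

lemma \<eta>_P: "x \<in> X \<Longrightarrow> \<eta> x \<in> P"
  using \<eta>_bij by (auto simp: bij_betw_def)

lemma \<eta>_inj: "x \<in> X \<Longrightarrow> y \<in> X \<Longrightarrow> \<eta> x = \<eta> y \<longleftrightarrow> x = y"
  using \<eta>_bij by (auto simp: bij_betw_def inj_on_def)

lemma Inc_carrier: "f \<in> carrier Inc \<longleftrightarrow> (\<forall>y x. f (y, x) \<noteq> 0 \<longrightarrow> (x, y) \<in> r)"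
  by (simp add: incidence_algebra_def)

text \<open>An element of the incidence algebra acts on the column vector of the summands as a matrix
  of scalars; its \<open>(y, x)\<close> entry is the component from the summand \<open>x\<close> to the summand \<open>y\<close>.\<close>

definition mat_act :: "('p \<times> 'p \<Rightarrow> 'k) \<Rightarrow> ('i \<Rightarrow> 'k laurent mat) \<Rightarrow> 'i \<Rightarrow> 'k laurent mat" where
  "mat_act f = (\<lambda>u\<in>carrier V.
     from_coord (\<lambda>y t. \<Sum>x\<in>X. Poly_Mapping.single 0 (f (\<eta> y, \<eta> x)) * coord u x t))"

text \<open>A nonzero coefficient at \<open>(\<eta> y, \<eta> x)\<close> means \<open>v y \<le> v x\<close>, so the summand \<open>x\<close> is mapped into the summand \<open>y\<close>.\<close>

lemma mat_act_closed:
  assumes f: "f \<in> carrier Inc" and u: "u \<in> carrier V"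
  shows "mat_act f u \<in> carrier V"
proof -
  have "supp_ge (v y t) (Poly_Mapping.single 0 (f (\<eta> y, \<eta> x)) * coord u x t)"
    if "x \<in> X" "y \<in> X" "t < n" for x y t
  proof (cases "f (\<eta> y, \<eta> x) = 0")
    case False
    then have "(\<eta> x, \<eta> y) \<in> r" using f by (simp add: Inc_carrier)
    then have "v y t \<le> v x t" using \<eta>_order that by simp
    then show ?thesis by (intro supp_ge_mult[OF _ coord_supp[OF u], of 0]) (use that in auto)
  qed simp
  then show ?thesis using u by (auto simp: mat_act_def intro!: from_coord_closed supp_ge_sum)
qed

lemma coord_mat_act:
  "u \<in> carrier V \<Longrightarrow> y \<in> X \<Longrightarrow> t < n \<Longrightarrow>
    coord (mat_act f u) y t = (\<Sum>x\<in>X. Poly_Mapping.single 0 (f (\<eta> y, \<eta> x)) * coord u x t)"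
  by (simp add: mat_act_def)

lemma coord_mat_act_gen:
  assumes "x \<in> X" "y \<in> X" "t < n" "s < n"
  shows "coord (mat_act f (gen x t)) y s = (if s = t then Poly_Mapping.single (v x t) (f (\<eta> y, \<eta> x)) else 0)"
proof -
  have "coord (mat_act f (gen x t)) y s
      = (\<Sum>x'\<in>X. if x' = x then (if s = t then Poly_Mapping.single (v x t) (f (\<eta> y, \<eta> x)) else 0) else 0)"
    unfolding coord_mat_act[OF gen_closed assms(2,4)]
    using assms by (intro sum.cong) (auto simp: mult_single)
  then show ?thesis using assms finite_index by simp
qed

lemma mat_act_hom:
  assumes f: "f \<in> carrier Inc"
  shows "mat_act f \<in> graded_hom A V V"
proof -
  have "mat_act f (u \<oplus>\<^bsub>V\<^esub> w) = mat_act f u \<oplus>\<^bsub>V\<^esub> mat_act f w"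
    if "u \<in> carrier V" "w \<in> carrier V" for u w
    by (rule V_eqI) (use that f in \<open>auto simp: mat_act_closed add_closed coord_mat_act distrib_left sum.distrib\<close>)
  moreover have "mat_act f (ract V u a) = ract V (mat_act f u) a"
    if u: "u \<in> carrier V" and a: "a \<in> carrier A" for u a
  proof (rule V_eqI)
    have am: "a \<in> carrier_mat n n" using a by (simp add: tiled_order_carrier)
    fix y t assume yt: "y \<in> X" "t < n"
    show "coord (mat_act f (ract V u a)) y t = coord (ract V (mat_act f u) a) y t"
      unfolding coord_mat_act[OF ract_closed[OF u a] yt] coord_ract[OF mat_act_closed[OF f u] am yt]
      using yt u am
      by (simp add: coord_mat_act coord_ract sum_distrib_left sum_distrib_right ac_simps)
        (rule sum.swap)
  qed (use f u a in \<open>auto simp: mat_act_closed ract_closed\<close>)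
  moreover have "mat_act f u \<in> hcomp V j" if "u \<in> hcomp V j" for u j
    using that f
    by (auto simp: hcomp_iff mat_act_closed coord_mat_act intro!: homog_sum homog_mult[OF homog_single[of 0]])
  moreover have "mat_act f \<in> carrier V \<rightarrow>\<^sub>E carrier V"
    using mat_act_closed[OF f] by (auto simp: mat_act_def)
  ultimately show ?thesis unfolding graded_hom_def module_hom_def by blast
qed

text \<open>Injectivity is seen on the generators; surjectivity is \<open>End_gen\<close>, since an endomorphism is
  determined by its values on the generators.\<close>

lemma mat_act_bij: "bij_betw mat_act (carrier Inc) (graded_hom A V V)"
  unfolding bij_betw_def
proof
  have r_P: "x \<in> P \<and> y \<in> P" if "(x, y) \<in> r" for x y using partial_order_onD(4)[OF order] that by auto
  show "inj_on mat_act (carrier Inc)"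
  proof (rule inj_onI, rule ext, clarify)
    fix f g q p assume f: "f \<in> carrier Inc" and g: "g \<in> carrier Inc" and eq: "mat_act f = mat_act g"
    show "f (q, p) = g (q, p)"
    proof (cases "q \<in> P \<and> p \<in> P")
      case True
      then obtain x y where xy: "x \<in> X" "y \<in> X" "p = \<eta> x" "q = \<eta> y"
        using \<eta>_bij by (auto simp: bij_betw_def)
      have "Poly_Mapping.single (v x 0) (f (q, p)) = Poly_Mapping.single (v x 0) (g (q, p))"
        using coord_mat_act_gen[OF xy(1,2) n_pos n_pos, of f] coord_mat_act_gen[OF xy(1,2) n_pos n_pos, of g]
        by (simp add: eq xy)
      then show ?thesis by (metis lookup_single_eq)
    next
      case False
      then have "f (q, p) = 0" "g (q, p) = 0" using f g r_P by (metis Inc_carrier)+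
      then show ?thesis by simp
    qed
  qed
  show "mat_act ` carrier Inc = graded_hom A V V"
  proof (intro equalityI subsetI)
    fix g assume g: "g \<in> graded_hom A V V"
    have "\<forall>x\<in>X. \<forall>y\<in>X. \<exists>c. (\<forall>t<n. \<forall>s<n.
        coord (g (gen x t)) y s = (if s = t then Poly_Mapping.single (v x t) c else 0)) \<and>
        (c \<noteq> 0 \<longrightarrow> (\<forall>t<n. v y t \<le> v x t))"
      using End_gen[OF g] by (metis (no_types, lifting))
    then obtain c where c: "\<And>x y t s. x \<in> X \<Longrightarrow> y \<in> X \<Longrightarrow> t < n \<Longrightarrow> s < n \<Longrightarrow>
        coord (g (gen x t)) y s = (if s = t then Poly_Mapping.single (v x t) (c x y) else 0)"
      and c_order: "\<And>x y t. x \<in> X \<Longrightarrow> y \<in> X \<Longrightarrow> c x y \<noteq> 0 \<Longrightarrow> t < n \<Longrightarrow> v y t \<le> v x t"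
      by metis
    define f where "f = (\<lambda>(q, p). if q \<in> P \<and> p \<in> P
      then c (the_inv_into X \<eta> p) (the_inv_into X \<eta> q) else 0)"
    have f_eq: "f (\<eta> y, \<eta> x) = c x y" if "x \<in> X" "y \<in> X" for x y
      using that \<eta>_P \<eta>_bij by (simp add: f_def the_inv_into_f_f bij_betw_def)
    have "f \<in> carrier Inc"
      unfolding Inc_carrier
    proof (intro allI impI)
      fix q p assume nz: "f (q, p) \<noteq> 0"
      then have "q \<in> P" "p \<in> P" by (auto simp: f_def split: if_splits)
      then obtain x y where xy: "x \<in> X" "y \<in> X" "p = \<eta> x" "q = \<eta> y"
        using \<eta>_bij by (auto simp: bij_betw_def)
      then show "(p, q) \<in> r" using nz f_eq[OF xy(1,2)] c_order[OF xy(1,2)] \<eta>_order by simp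
    qed
    moreover from this have "g = mat_act f"
    proof (intro End_eqI)
      assume f: "f \<in> carrier Inc"
      show "g \<in> module_hom A V V" using g by (simp add: graded_hom_def)
      then have g_cl: "g u \<in> carrier V" if "u \<in> carrier V" for u
        using that by (auto simp: module_hom_def)
      show "mat_act f \<in> module_hom A V V" using mat_act_hom[OF f] by (simp add: graded_hom_def)
      show "g (gen x t) = mat_act f (gen x t)" if "x \<in> X" "t < n" for x t
        by (rule V_eqI) (use that f in
          \<open>auto simp: g_cl mat_act_closed gen_closed coord_mat_act_gen c f_eq\<close>)
    qed
    ultimately show "g \<in> mat_act ` carrier Inc" by blast
  qed (use mat_act_hom in blast)
qed

lemma sum_P: "(\<Sum>q\<in>P. F q) = (\<Sum>x\<in>X. F (\<eta> x))"
  using sum.reindex_bij_betw[OF \<eta>_bij, of F] by simp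

lemma mat_act_mult:
  assumes f: "f \<in> carrier Inc" and g: "g \<in> carrier Inc"
  shows "f \<otimes>\<^bsub>Inc\<^esub> g \<in> carrier Inc"
    and "mat_act (f \<otimes>\<^bsub>Inc\<^esub> g) = compose (carrier V) (mat_act f) (mat_act g)"
proof -
  have fg: "(f \<otimes>\<^bsub>Inc\<^esub> g) (q, p) = (\<Sum>z\<in>P. f (q, z) * g (z, p))" for q p
    by (simp add: incidence_algebra_def)
  show cl: "f \<otimes>\<^bsub>Inc\<^esub> g \<in> carrier Inc"
    unfolding Inc_carrier fg
  proof (intro allI impI)
    fix q p assume "(\<Sum>z\<in>P. f (q, z) * g (z, p)) \<noteq> 0"
    then obtain z where "f (q, z) * g (z, p) \<noteq> 0"
      by (rule sum.not_neutral_contains_not_neutral)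
    then have "(p, z) \<in> r" "(z, q) \<in> r" using f g by (auto simp: Inc_carrier)
    then show "(p, q) \<in> r" by (rule transD[OF partial_order_onD(2)[OF order]])
  qed
  show "mat_act (f \<otimes>\<^bsub>Inc\<^esub> g) = compose (carrier V) (mat_act f) (mat_act g)"
  proof (rule extensionalityI[where A = "carrier V"])
    fix u assume u: "u \<in> carrier V"
    have "mat_act (f \<otimes>\<^bsub>Inc\<^esub> g) u = mat_act f (mat_act g u)"
    proof (rule V_eqI)
      fix y t assume yt: "y \<in> X" "t < n"
      have "coord (mat_act (f \<otimes>\<^bsub>Inc\<^esub> g) u) y t
          = (\<Sum>x\<in>X. (\<Sum>z\<in>X. Poly_Mapping.single 0 (f (\<eta> y, \<eta> z)) * Poly_Mapping.single 0 (g (\<eta> z, \<eta> x))) * coord u x t)"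
        unfolding coord_mat_act[OF u yt] fg sum_P
        by (simp only: mult_single single_sum add_0_left)
      also have "\<dots> = (\<Sum>z\<in>X. Poly_Mapping.single 0 (f (\<eta> y, \<eta> z)) * (\<Sum>x\<in>X. Poly_Mapping.single 0 (g (\<eta> z, \<eta> x)) * coord u x t))"
        unfolding sum_distrib_left sum_distrib_right mult.assoc by (rule sum.swap)
      also have "\<dots> = coord (mat_act f (mat_act g u)) y t"
        using yt u by (simp add: coord_mat_act mat_act_closed[OF g])
      finally show "coord (mat_act (f \<otimes>\<^bsub>Inc\<^esub> g) u) y t = coord (mat_act f (mat_act g u)) y t" .
    qed (use f g u cl in \<open>auto simp: mat_act_closed\<close>)
    then show "mat_act (f \<otimes>\<^bsub>Inc\<^esub> g) u = compose (carrier V) (mat_act f) (mat_act g) u"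
      using u by (simp add: compose_def)
  qed (auto simp: mat_act_def compose_def)
qed

lemma mat_act_add:
  assumes f: "f \<in> carrier Inc" and g: "g \<in> carrier Inc"
  shows "f \<oplus>\<^bsub>Inc\<^esub> g \<in> carrier Inc"
    and "mat_act (f \<oplus>\<^bsub>Inc\<^esub> g) = (\<lambda>u\<in>carrier V. mat_act f u \<oplus>\<^bsub>V\<^esub> mat_act g u)"
proof -
  have fg: "(f \<oplus>\<^bsub>Inc\<^esub> g) p = f p + g p" for p by (simp add: incidence_algebra_def)
  show cl: "f \<oplus>\<^bsub>Inc\<^esub> g \<in> carrier Inc"
    using f g unfolding Inc_carrier fg by (metis add.right_neutral)
  show "mat_act (f \<oplus>\<^bsub>Inc\<^esub> g) = (\<lambda>u\<in>carrier V. mat_act f u \<oplus>\<^bsub>V\<^esub> mat_act g u)"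
  proof (rule extensionalityI[where A = "carrier V"])
    fix u assume u: "u \<in> carrier V"
    have "mat_act (f \<oplus>\<^bsub>Inc\<^esub> g) u = mat_act f u \<oplus>\<^bsub>V\<^esub> mat_act g u"
      by (rule V_eqI) (use u f g cl in
        \<open>auto simp: mat_act_closed add_closed coord_mat_act fg single_add distrib_right sum.distrib\<close>)
    then show "mat_act (f \<oplus>\<^bsub>Inc\<^esub> g) u = (\<lambda>u\<in>carrier V. mat_act f u \<oplus>\<^bsub>V\<^esub> mat_act g u) u"
      using u by simp
  qed (auto simp: mat_act_def)
qed

lemma mat_act_smult:
  assumes f: "f \<in> carrier Inc"
  shows "c \<odot>\<^bsub>Inc\<^esub> f \<in> carrier Inc"
    and "mat_act (c \<odot>\<^bsub>Inc\<^esub> f) = (\<lambda>u\<in>carrier V. ract V (mat_act f u) (Poly_Mapping.single 0 c \<cdot>\<^sub>m 1\<^sub>m n))"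
proof -
  have cf: "(c \<odot>\<^bsub>Inc\<^esub> f) p = c * f p" for p by (simp add: incidence_algebra_def)
  show cl: "c \<odot>\<^bsub>Inc\<^esub> f \<in> carrier Inc"
    using f unfolding Inc_carrier cf by (metis mult_zero_right)
  have c_A: "Poly_Mapping.single 0 c \<cdot>\<^sub>m 1\<^sub>m n \<in> carrier A" by (rule smult_one_carrier[OF tiled]) simp
  show "mat_act (c \<odot>\<^bsub>Inc\<^esub> f) = (\<lambda>u\<in>carrier V. ract V (mat_act f u) (Poly_Mapping.single 0 c \<cdot>\<^sub>m 1\<^sub>m n))"
  proof (rule extensionalityI[where A = "carrier V"])
    fix u assume u: "u \<in> carrier V"
    have "mat_act (c \<odot>\<^bsub>Inc\<^esub> f) u = ract V (mat_act f u) (Poly_Mapping.single 0 c \<cdot>\<^sub>m 1\<^sub>m n)"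
    proof (rule V_eqI)
      fix y t assume yt: "y \<in> X" "t < n"
      have eq: "Poly_Mapping.single 0 (c * f (\<eta> y, \<eta> x)) * coord u x t
          = Poly_Mapping.single 0 (f (\<eta> y, \<eta> x)) * coord u x t * Poly_Mapping.single 0 c" for x
      proof -
        have "Poly_Mapping.single (0::int) (c * f (\<eta> y, \<eta> x))
            = Poly_Mapping.single 0 c * Poly_Mapping.single 0 (f (\<eta> y, \<eta> x))"
          by (simp add: mult_single)
        then show ?thesis by (simp only: ac_simps)
      qed
      show "coord (mat_act (c \<odot>\<^bsub>Inc\<^esub> f) u) y t
          = coord (ract V (mat_act f u) (Poly_Mapping.single 0 c \<cdot>\<^sub>m 1\<^sub>m n)) y t"
        unfolding coord_ract_scalar[OF mat_act_closed[OF f u] yt] coord_mat_act[OF u yt] cf eq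
          sum_distrib_right ..
    qed (use f u cl c_A in \<open>auto simp: mat_act_closed ract_closed\<close>)
    then show "mat_act (c \<odot>\<^bsub>Inc\<^esub> f) u
        = (\<lambda>u\<in>carrier V. ract V (mat_act f u) (Poly_Mapping.single 0 c \<cdot>\<^sub>m 1\<^sub>m n)) u" using u by simp
  qed (auto simp: mat_act_def)
qed

lemma mat_act_one:
  shows "\<one>\<^bsub>Inc\<^esub> \<in> carrier Inc" and "mat_act \<one>\<^bsub>Inc\<^esub> = (\<lambda>u\<in>carrier V. u)"
proof -
  have one: "\<one>\<^bsub>Inc\<^esub> (q, p) = (if q = p \<and> p \<in> P then 1 else 0)" for q p
    by (simp add: incidence_algebra_def)
  show cl: "\<one>\<^bsub>Inc\<^esub> \<in> carrier Inc"
    using partial_order_onD(1)[OF order] unfolding Inc_carrier one by (auto simp: refl_on_def split: if_splits)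
  show "mat_act \<one>\<^bsub>Inc\<^esub> = (\<lambda>u\<in>carrier V. u)"
  proof (rule extensionalityI[where A = "carrier V"])
    fix u assume u: "u \<in> carrier V"
    have "mat_act \<one>\<^bsub>Inc\<^esub> u = u"
    proof (rule V_eqI[OF mat_act_closed[OF cl u] u])
      fix y t assume yt: "y \<in> X" "t < n"
      have "coord (mat_act \<one>\<^bsub>Inc\<^esub> u) y t = (\<Sum>x\<in>X. if x = y then coord u x t else 0)"
        unfolding coord_mat_act[OF u yt] one using yt \<eta>_P \<eta>_inj by (intro sum.cong) auto
      then show "coord (mat_act \<one>\<^bsub>Inc\<^esub> u) y t = coord u y t" using yt finite_index by simp
    qed
    then show "mat_act \<one>\<^bsub>Inc\<^esub> u = (\<lambda>u\<in>carrier V. u) u" using u by simp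
  qed (auto simp: mat_act_def)
qed

lemma zero_End: "(\<lambda>u\<in>carrier V. \<zero>\<^bsub>V\<^esub>) \<in> graded_hom A V V"
proof -
  note zero_add_zero
  then show ?thesis
    by (auto simp: graded_hom_def module_hom_def zero_closed add_closed ract_closed ract_zero hcomp_iff)
qed

lemma stable_End_V:
  assumes nonneg: "\<And>x t. x \<in> X \<Longrightarrow> t < n \<Longrightarrow> 0 \<le> v x t"
    and obstruct: "\<And>k. k < n \<Longrightarrow> \<exists>\<tau><n. \<forall>x\<in>X. v x \<tau> < d k \<tau>"
  shows "algebra_isomorphic (stable_End n d V) Inc"
  unfolding stable_End_def
proof (rule algebra_isomorphic_quotient_by_zero[where \<Psi> = mat_act])
  let ?E = "graded_End n d V"
  have E: "carrier ?E = graded_hom A V V" "\<zero>\<^bsub>?E\<^esub> = (\<lambda>u\<in>carrier V. \<zero>\<^bsub>V\<^esub>)"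
    "\<one>\<^bsub>?E\<^esub> = (\<lambda>u\<in>carrier V. u)" "f \<otimes>\<^bsub>?E\<^esub> g = compose (carrier V) f g"
    "f \<oplus>\<^bsub>?E\<^esub> g = (\<lambda>u\<in>carrier V. f u \<oplus>\<^bsub>V\<^esub> g u)"
    "c \<odot>\<^bsub>?E\<^esub> f = (\<lambda>u\<in>carrier V. ract V (f u) (Poly_Mapping.single 0 c \<cdot>\<^sub>m 1\<^sub>m n))" for f g c
    by (simp_all add: graded_End_def)
  show "{f \<in> carrier ?E. factors_through_projective A V V f} = {\<zero>\<^bsub>?E\<^esub>}"
    unfolding E
    using factors_through_projective_zero[OF nonneg obstruct] zero_factors_through_projective zero_End
    by blast
  show "\<zero>\<^bsub>?E\<^esub> \<oplus>\<^bsub>?E\<^esub> f = f" if f: "f \<in> carrier ?E" for f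
    unfolding E
  proof (rule extensionalityI[where A = "carrier V"])
    interpret abelian_group V by (rule V_abelian_group)
    fix u assume u: "u \<in> carrier V"
    then have "f u \<in> carrier V" using f unfolding E graded_hom_def module_hom_def by blast
    then show "(\<lambda>u\<in>carrier V. (\<lambda>u\<in>carrier V. \<zero>\<^bsub>V\<^esub>) u \<oplus>\<^bsub>V\<^esub> f u) u = f u" using u by simp
  next
    show "f \<in> extensional (carrier V)"
      using f unfolding E graded_hom_def module_hom_def PiE_def by blast
  qed simp
  show "bij_betw mat_act (carrier Inc) (carrier ?E)" unfolding E by (rule mat_act_bij)
  show "\<one>\<^bsub>Inc\<^esub> \<in> carrier Inc" "mat_act \<one>\<^bsub>Inc\<^esub> = \<one>\<^bsub>?E\<^esub>" unfolding E by (rule mat_act_one)+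
  show "f \<oplus>\<^bsub>Inc\<^esub> g \<in> carrier Inc \<and> mat_act (f \<oplus>\<^bsub>Inc\<^esub> g) = mat_act f \<oplus>\<^bsub>?E\<^esub> mat_act g"
    if "f \<in> carrier Inc" "g \<in> carrier Inc" for f g
    unfolding E using mat_act_add[OF that] ..
  show "f \<otimes>\<^bsub>Inc\<^esub> g \<in> carrier Inc \<and> mat_act (f \<otimes>\<^bsub>Inc\<^esub> g) = mat_act f \<otimes>\<^bsub>?E\<^esub> mat_act g"
    if "f \<in> carrier Inc" "g \<in> carrier Inc" for f g
    unfolding E using mat_act_mult[OF that] ..
  show "c \<odot>\<^bsub>Inc\<^esub> f \<in> carrier Inc \<and> mat_act (c \<odot>\<^bsub>Inc\<^esub> f) = c \<odot>\<^bsub>?E\<^esub> mat_act f"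
    if "f \<in> carrier Inc" for f c
    unfolding E using mat_act_smult[OF that] ..
qed

end

section \<open>The standard tilting object as a direct sum of row lattices\<close>

text \<open>The lattice \<open>L\<^sub>e\<close>, placed into row \<open>k\<close> of the \<open>n \<times> n\<close> matrices.\<close>

definition row_lattice :: "nat \<Rightarrow> nat \<Rightarrow> (nat \<Rightarrow> int) \<Rightarrow> 'k::field laurent mat set" where
  "row_lattice n k e = {m \<in> carrier_mat n n. \<forall>s<n. \<forall>t<n.
     if s = k then supp_ge (e t) (m $$ (s, t)) else m $$ (s, t) = 0}"

lemma idem_mult_entry:
  assumes "a \<in> carrier_mat n n" "k < n" "s < n" "t < n"
  shows "(idem n k * a) $$ (s, t) = (if s = k then a $$ (k, t) else 0)"
proof -
  have c: "idem n k \<in> carrier_mat n n" by (simp add: idem_def)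
  have "(idem n k * a) $$ (s, t) = (\<Sum>l<n. if l = k then (if s = k then a $$ (k, t) else 0) else 0)"
    unfolding mat_mult_entry[OF c assms(1,3,4)] using assms by (intro sum.cong) (auto simp: idem_def)
  then show ?thesis using assms by simp
qed

lemma idem_carrier [simp]: "idem n k \<in> carrier_mat n n"
  by (simp add: idem_def)

lemma indec_projective_eq:
  assumes "k < n"
  shows "indec_projective n d k
    = (matrix_module n n (row_lattice n k (d k)) :: ('k::field laurent mat, 'k laurent mat) gmodule)"
proof -
  have "(\<lambda>a. idem n k * a) ` carrier (tiled_order n d)
      = (row_lattice n k (d k) :: 'k laurent mat set)"
  proof (intro equalityI subsetI)
    fix m :: "'k laurent mat" assume "m \<in> (\<lambda>a. idem n k * a) ` carrier (tiled_order n d)"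
    then obtain a where a: "a \<in> carrier (tiled_order n d)" "m = idem n k * a" by blast
    then have "a \<in> carrier_mat n n" by (simp add: tiled_order_carrier)
    then show "m \<in> row_lattice n k (d k)"
      using a assms mult_carrier_mat[OF idem_carrier, of a n n k]
      by (simp add: row_lattice_def idem_mult_entry tiled_order_carrier)
  next
    fix m :: "'k laurent mat" assume m: "m \<in> row_lattice n k (d k)"
    then have mc: "m \<in> carrier_mat n n" by (simp add: row_lattice_def)
    have "m \<in> carrier (tiled_order n d)"
      using m unfolding row_lattice_def tiled_order_carrier by (force split: if_splits)
    moreover have "m = idem n k * m"
      by (rule eq_matI)
        (use m mc assms mult_carrier_mat[OF idem_carrier mc, of k] in
          \<open>auto simp: idem_mult_entry row_lattice_def simp del: index_mult_mat(1)\<close>)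
    ultimately show "m \<in> (\<lambda>a. idem n k * a) ` carrier (tiled_order n d)" by blast
  qed
  then show ?thesis by (simp add: indec_projective_def)
qed

lemma matrix_finsum_entry:
  assumes "abelian_monoid N" "carrier N \<subseteq> carrier_mat a b" "add N = (+)" "\<zero>\<^bsub>N\<^esub> = 0\<^sub>m a b"
    and "finite F" "c \<in> F \<rightarrow> carrier N" "s < a" "t < b"
  shows "finsum N c F $$ (s, t) = (\<Sum>l\<in>F. c l $$ (s, t))"
  using assms(5,6)
proof (induction F rule: finite_induct)
  interpret abelian_monoid N by (rule assms(1))
  case empty
  then show ?case using assms by (simp add: finsum_empty)
next
  interpret abelian_monoid N by (rule assms(1))
  case (insert l F)
  then have "finsum N c F \<in> carrier_mat a b" using assms(2) finsum_closed[of c F] by auto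
  then show ?case using insert assms by (simp add: finsum_insert Pi_def)
qed

lemma row_lattice_mat: "m \<in> row_lattice n k e \<Longrightarrow> m \<in> carrier_mat n n"
  by (simp add: row_lattice_def)

lemma row_lattice_zero: "0\<^sub>m n n \<in> row_lattice n k e"
  by (simp add: row_lattice_def)

lemma row_lattice_add:
  "m \<in> row_lattice n k e \<Longrightarrow> m' \<in> row_lattice n k e \<Longrightarrow> m + m' \<in> row_lattice n k e"
  by (auto simp: row_lattice_def intro!: supp_ge_add split: if_splits)

text \<open>Elements of degree at least \<open>0\<close> in the grading shifted by \<open>j\<close> are those of degree at least \<open>j\<close> in the original
  one, so truncation raises all exponents to at least \<open>j\<close>. Conversely, an element of the
  smaller lattice is the sum of its homogeneous components, which all have degree at least \<open>j\<close>.\<close>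

lemma nonneg_part_row_lattice:
  assumes k: "k < n"
  shows "carrier (nonneg_part (shift_module j (matrix_module n n (row_lattice n k e))))
    = (row_lattice n k (\<lambda>t. max (e t) j) :: 'k::field laurent mat set)"
proof -
  let ?N = "shift_module j (matrix_module n n (row_lattice n k e :: 'k laurent mat set))"
  have N: "carrier ?N = row_lattice n k e" "add ?N = (+)" "\<zero>\<^bsub>?N\<^esub> = 0\<^sub>m n n"
    "hcomp ?N l = {m \<in> row_lattice n k e. homogeneous_mat (l + j) m}" for l
    by (simp_all add: shift_module_def matrix_module_def)
  have mono: "abelian_monoid ?N"
  proof (rule abelian_monoidI, unfold N)
    show "m + m' + m'' = m + (m' + m'')" "m + m' = m' + m" "0\<^sub>m n n + m = m"
      if "m \<in> row_lattice n k e" "m' \<in> row_lattice n k e" "m'' \<in> row_lattice n k e" for m m' m'' :: "'k laurent mat"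
      using that[THEN row_lattice_mat] by (auto intro: assoc_add_mat comm_add_mat)
  qed (simp_all add: row_lattice_zero row_lattice_add)
  have sub: "carrier ?N \<subseteq> carrier_mat n n" by (auto simp: N row_lattice_mat)
  interpret abelian_monoid ?N by (rule mono)
  note entry = matrix_finsum_entry[OF mono sub N(2,3)]
  show ?thesis
  proof (intro equalityI subsetI)
    fix m assume "m \<in> carrier (nonneg_part ?N)"
    then obtain c F where m: "m = finsum ?N c F" and F: "finite F" "F \<subseteq> {0..}"
      and c: "\<forall>l\<in>F. c l \<in> hcomp ?N l"
      by (auto simp: nonneg_part_def)
    have cF: "c \<in> F \<rightarrow> carrier ?N" using c by (auto simp: N)
    have mN: "m \<in> row_lattice n k e" using finsum_closed[OF cF] by (simp add: m N)
    have "supp_ge (max (e t) j) (m $$ (k, t))" if t: "t < n" for t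
      unfolding m entry[OF F(1) cF k t]
    proof (rule supp_ge_sum)
      fix l assume l: "l \<in> F"
      then have "c l \<in> row_lattice n k e" "homogeneous_mat (l + j) (c l)" "0 \<le> l"
        using c F by (auto simp: N)
      then have "homog (l + j) (c l $$ (k, t))" "supp_ge (e t) (c l $$ (k, t))"
        using k t by (auto simp: row_lattice_def homogeneous_mat_iff)
      then show "supp_ge (max (e t) j) (c l $$ (k, t))"
        using \<open>0 \<le> l\<close> by (intro homog_supp_ge_max) auto
    qed
    then show "m \<in> row_lattice n k (\<lambda>t. max (e t) j)" using mN by (auto simp: row_lattice_def)
  next
    fix m :: "'k laurent mat" assume m: "m \<in> row_lattice n k (\<lambda>t. max (e t) j)"
    define K where "K = (\<Union>t<n. Poly_Mapping.keys (m $$ (k, t)))"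
    define F where "F = (\<lambda>i. i - j) ` K"
    define c where "c l = mat n n (\<lambda>(s, t).
      if s = k then Poly_Mapping.single (l + j) (Poly_Mapping.lookup (m $$ (k, t)) (l + j)) else 0)" for l
    have supp: "supp_ge (max (e t) j) (m $$ (k, t))" if "t < n" for t
      using m k that by (auto simp: row_lattice_def)
    have "finite K" by (simp add: K_def)
    moreover have "j \<le> i" if i: "i \<in> K" for i
    proof -
      obtain t where t: "t < n" "Poly_Mapping.lookup (m $$ (k, t)) i \<noteq> 0"
        using i unfolding K_def in_keys_iff by blast
      from supp_ge_lookup[OF supp[OF t(1)] t(2)] show ?thesis by simp
    qed
    ultimately have F: "finite F" "F \<subseteq> {0..}" unfolding F_def by auto
    have c: "c l \<in> hcomp ?N l" for l
      unfolding N using supp_ge_lookup[OF supp]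
      by (auto simp: c_def row_lattice_def homogeneous_mat_iff)
    have cF: "c \<in> F \<rightarrow> carrier ?N" using c by (auto simp: N)
    have "m = finsum ?N c F"
    proof (rule eq_matI)
      have fc: "finsum ?N c F \<in> carrier_mat n n" using finsum_closed[OF cF] sub by blast
      then show "dim_row m = dim_row (finsum ?N c F)" "dim_col m = dim_col (finsum ?N c F)"
        using m by (auto simp: row_lattice_def)
      fix s t assume "s < dim_row (finsum ?N c F)" "t < dim_col (finsum ?N c F)"
      then have st: "s < n" "t < n" using fc by auto
      have "(\<Sum>l\<in>F. c l $$ (k, t))
          = (\<Sum>l\<in>F. Poly_Mapping.single (l + j) (Poly_Mapping.lookup (m $$ (k, t)) (l + j)))"
        using k st by (simp add: c_def)
      also have "\<dots> = (\<Sum>i\<in>K. Poly_Mapping.single i (Poly_Mapping.lookup (m $$ (k, t)) i))"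
        unfolding F_def by (subst sum.reindex) (auto simp: inj_on_def)
      also have "\<dots> = m $$ (k, t)" by (rule sum_monomials) (use st in \<open>auto simp: K_def\<close>)
      finally have row: "(\<Sum>l\<in>F. c l $$ (k, t)) = m $$ (k, t)" .
      show "m $$ (s, t) = finsum ?N c F $$ (s, t)"
        unfolding entry[OF F(1) cF st]
      proof (cases "s = k")
        case True
        then show "m $$ (s, t) = (\<Sum>l\<in>F. c l $$ (s, t))" by (simp only: row)
      next
        case False
        then show "m $$ (s, t) = (\<Sum>l\<in>F. c l $$ (s, t))"
          using m st by (simp add: row_lattice_def c_def)
      qed
    qed
    then show "m \<in> carrier (nonneg_part ?N)"
      using F c unfolding nonneg_part_def by auto
  qed
qed

lemma nakayama_eq:
  assumes "basic n d" "nakayama_condition n d \<nu>"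
  shows "nakayama n d = \<nu>"
  unfolding nakayama_def using assms nakayama_unique[OF assms(1)] by (intro the_equality) auto

text \<open>The data of the locale \<open>row_lattices\<close> for the summands of the standard tilting object. The
  exponents are those of \<open>nonneg_part_row_lattice\<close>, lowered by the shift \<open>j\<close>.\<close>

fun summand_rows :: "nat \<Rightarrow> (nat \<times> int) option \<Rightarrow> nat" where
  "summand_rows n None = 1"
| "summand_rows n (Some _) = n"

fun summand_row :: "(nat \<Rightarrow> nat) \<Rightarrow> (nat \<times> int) option \<Rightarrow> nat" where
  "summand_row \<nu> None = 0"
| "summand_row \<nu> (Some (i, j)) = \<nu> i"

fun summand_shift :: "(nat \<times> int) option \<Rightarrow> int" where
  "summand_shift None = 0"
| "summand_shift (Some (i, j)) = j"

fun summand_exponent :: "(nat \<Rightarrow> nat) \<Rightarrow> (nat \<Rightarrow> nat \<Rightarrow> int) \<Rightarrow> (nat \<times> int) option \<Rightarrow> nat \<Rightarrow> int" where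
  "summand_exponent \<nu> d None t = 0"
| "summand_exponent \<nu> d (Some (i, j)) t = max (d (\<nu> i) t - j) 0"

lemma tilting_row_lattices:
  assumes tiled: "tiled_order_exponents n d" and basic: "basic n d" and nonneg: "nonneg_graded n d"
    and nak: "nakayama_condition n d \<nu>"
  shows "row_lattices n d (tilting_index n d) (summand_rows n) (summand_row \<nu>) summand_shift
    (summand_exponent \<nu> d)
    (tilting_summand n d :: _ \<Rightarrow> ('k::field laurent mat, 'k laurent mat) gmodule)"
proof -
  have nu: "nakayama n d = \<nu>" by (rule nakayama_eq[OF basic nak])
  have \<nu>: "\<nu> i < n" if "i < n" for i
    using nak that permutes_in_image unfolding nakayama_condition_def by (metis lessThan_iff)
  have index: "x = None \<or> (\<exists>i j. x = Some (i, j) \<and> i < n \<and> 1 \<le> j)" if "x \<in> tilting_index n d" for x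
    using that by (auto simp: tilting_index_def)
  let ?M = "tilting_summand n d :: _ \<Rightarrow> ('k laurent mat, 'k laurent mat) gmodule"
  have M: "?M (Some (i, j)) = nonneg_part (shift_module j (matrix_module n n (row_lattice n (\<nu> i) (d (\<nu> i)))))"
    if "i < n" for i j
    by (simp add: nu indec_projective_eq[OF \<nu>[OF that]])
  have car: "carrier (?M (Some (i, j))) = row_lattice n (\<nu> i) (\<lambda>t. max (d (\<nu> i) t) j)" if "i < n" for i j
    unfolding M[OF that] by (rule nonneg_part_row_lattice[OF \<nu>[OF that]])
  have max_eq: "max (a - j) 0 + j = max a j" for a j :: int by linarith
  show ?thesis
  proof (rule row_lattices.intro)
    show "tiled_order_exponents n d" by (rule tiled)
    have "tilting_index n d \<subseteq> insert None (Some ` (\<Union>i<n. {i} \<times> {1..- p_invariant n d i}))"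
      by (auto simp: tilting_index_def)
    then show "finite (tilting_index n d)" by (rule finite_subset) auto
  next
    fix x assume x: "x \<in> tilting_index n d"
    show "summand_row \<nu> x < summand_rows n x"
      using index[OF x] \<nu> by auto
    show "summand_exponent \<nu> d x j \<le> summand_exponent \<nu> d x i + d i j" if ij: "i < n" "j < n" for i j
    proof -
      have "0 \<le> d i j" using nonneg ij by (simp add: nonneg_graded_def)
      moreover have "d (\<nu> k) j \<le> d (\<nu> k) i + d i j" if "k < n" for k
        using tiled ij \<nu>[OF that] by (simp add: tiled_order_exponents_def)
      ultimately show ?thesis using index[OF x] by fastforce
    qed
    show "carrier (?M x) = {m \<in> carrier_mat (summand_rows n x) n. \<forall>s<summand_rows n x. \<forall>t<n.
        if s = summand_row \<nu> x then supp_ge (summand_exponent \<nu> d x t + summand_shift x) (m $$ (s, t))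
        else m $$ (s, t) = 0}"
    proof (cases x)
      case None
      then show ?thesis by (auto simp: row_module_def matrix_module_def poly_ring_carrier)
    next
      case (Some p)
      then show ?thesis using index[OF x] car by (auto simp: row_lattice_def max_eq simp del: tilting_summand.simps)
    qed
    show "\<zero>\<^bsub>?M x\<^esub> = 0\<^sub>m (summand_rows n x) n" "add (?M x) = (+)" "ract (?M x) = (*)"
      using index[OF x] by (auto simp: row_module_def indec_projective_def matrix_module_def
          shift_module_def nonneg_part_def)
    show "hcomp (?M x) l = {m \<in> carrier (?M x). homogeneous_mat (l + summand_shift x) m}" for l
    proof (cases x)
      case None
      then show ?thesis by (simp add: row_module_def matrix_module_def)
    next
      case (Some p)
      then obtain i j where ij: "x = Some (i, j)" "i < n" using index[OF x] by auto
      note k = \<nu>[OF ij(2)]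
      have "hcomp (?M x) l = (if 0 \<le> l
          then {m \<in> row_lattice n (\<nu> i) (d (\<nu> i)). homogeneous_mat (l + j) m} else {0\<^sub>m n n})"
        unfolding ij(1) M[OF ij(2)] by (simp add: nonneg_part_def shift_module_def matrix_module_def)
      also have "\<dots> = {m \<in> row_lattice n (\<nu> i) (\<lambda>t. max (d (\<nu> i) t) j). homogeneous_mat (l + j) m}"
      proof (intro equalityI subsetI)
        fix m :: "'k laurent mat"
        assume m: "m \<in> (if 0 \<le> l
          then {m \<in> row_lattice n (\<nu> i) (d (\<nu> i)). homogeneous_mat (l + j) m} else {0\<^sub>m n n})"
        show "m \<in> {m \<in> row_lattice n (\<nu> i) (\<lambda>t. max (d (\<nu> i) t) j). homogeneous_mat (l + j) m}"
        proof (cases "0 \<le> l")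
          case True
          then have mm: "m \<in> row_lattice n (\<nu> i) (d (\<nu> i))" "homogeneous_mat (l + j) m" using m by auto
          then have "supp_ge (max (d (\<nu> i) t) j) (m $$ (\<nu> i, t))" if "t < n" for t
            using True k that
            by (intro homog_supp_ge_max[of "l + j"]) (auto simp: row_lattice_def homogeneous_mat_iff)
          then show ?thesis using mm by (auto simp: row_lattice_def)
        next
          case False
          then show ?thesis using m by (auto simp: row_lattice_def homogeneous_mat_iff)
        qed
      next
        fix m :: "'k laurent mat"
        assume "m \<in> {m \<in> row_lattice n (\<nu> i) (\<lambda>t. max (d (\<nu> i) t) j). homogeneous_mat (l + j) m}"
        then have m: "m \<in> row_lattice n (\<nu> i) (\<lambda>t. max (d (\<nu> i) t) j)" "homogeneous_mat (l + j) m" by auto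
        have supp: "supp_ge (max (d (\<nu> i) t) j) (m $$ (\<nu> i, t))"
          and homog: "homog (l + j) (m $$ (\<nu> i, t))" if "t < n" for t
          using m k that by (auto simp: row_lattice_def homogeneous_mat_iff)
        show "m \<in> (if 0 \<le> l
          then {m \<in> row_lattice n (\<nu> i) (d (\<nu> i)). homogeneous_mat (l + j) m} else {0\<^sub>m n n})"
        proof (cases "0 \<le> l")
          case True
          have "supp_ge (d (\<nu> i) t) (m $$ (\<nu> i, t))" if "t < n" for t
            using supp[OF that] by (rule supp_ge_mono) simp
          then show ?thesis using True m by (auto simp: row_lattice_def)
        next
          case False
          have "m $$ (\<nu> i, t) = 0" if "t < n" for t
            by (rule homog_supp_ge_zero[OF homog[OF that] supp[OF that]]) (use False in simp)
          then have "m = 0\<^sub>m n n"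
            using m(1) by (intro eq_matI) (auto simp: row_lattice_def split: if_splits)
          then show ?thesis using False by simp
        qed
      qed
      finally show ?thesis unfolding ij(1) car[OF ij(2)] by simp
    qed
  qed
qed

text \<open>The assumption \<open>sep\<close> is what keeps projectives from interfering. For a row \<open>k\<close> of the order, the column
  \<open>\<tau>\<close> with \<open>\<nu> \<tau> = k\<close> has \<open>d k \<tau>\<close> equal to the \<open>b\<close>-invariant of \<open>\<tau>\<close>. If this is \<open>2\<close>, it exceeds every exponent of
  \<open>V\<close>, which is at most \<open>1\<close>. If it is \<open>1\<close>, then \<open>sep\<close> says that \<open>\<tau>\<close> is in none of the sets
  \<open>{t. d t i = 0}\<close> that belong to the summands, so the exponents of \<open>V\<close> in this column are \<open>0\<close>.\<close>

lemma standard_tilting_stable_End: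
  fixes P :: "'p set" and r :: "'p rel" and \<eta> :: "(nat \<times> int) option \<Rightarrow> 'p"
  assumes tiled: "tiled_order_exponents n d" and basic: "basic n d" and nonneg: "nonneg_graded n d"
    and nak: "nakayama_condition n d \<nu>" and b: "\<And>i. i < n \<Longrightarrow> d (\<nu> i) i \<in> {1, 2}"
    and sep: "\<And>t i. t < n \<Longrightarrow> i < n \<Longrightarrow> d (\<nu> t) t = 1 \<Longrightarrow> d (\<nu> i) i = 2 \<Longrightarrow> 0 < d t i"
    and order: "partial_order_on P r"
    and \<eta>: "bij_betw \<eta> (tilting_index n d) P"
      "\<And>x y. x \<in> tilting_index n d \<Longrightarrow> y \<in> tilting_index n d \<Longrightarrow>
        (\<eta> x, \<eta> y) \<in> r \<longleftrightarrow> (\<forall>t<n. summand_exponent \<nu> d y t \<le> summand_exponent \<nu> d x t)"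
  shows "CM_object n d
      (standard_tilting n d :: ('k::field laurent mat, (nat \<times> int) option \<Rightarrow> 'k laurent mat) gmodule) \<and>
    algebra_isomorphic
      (stable_End n d
        (standard_tilting n d :: ('k laurent mat, (nat \<times> int) option \<Rightarrow> 'k laurent mat) gmodule))
      (incidence_algebra P r)"
proof -
  let ?M = "tilting_summand n d :: _ \<Rightarrow> ('k laurent mat, 'k laurent mat) gmodule"
  have lattices: "row_lattices n d (tilting_index n d) (summand_rows n) (summand_row \<nu>) summand_shift
      (summand_exponent \<nu> d) ?M"
    by (rule tilting_row_lattices[OF tiled basic nonneg nak])
  interpret poset_lattices n d "tilting_index n d" "summand_rows n" "summand_row \<nu>" summand_shift
    "summand_exponent \<nu> d" ?M P r \<eta>
    by (intro poset_lattices.intro lattices poset_lattices_axioms.intro order \<eta>)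
  have V: "V = standard_tilting n d" by (simp add: V_def standard_tilting_def)
  have nu: "nakayama n d = \<nu>" by (rule nakayama_eq[OF basic nak])
  have "0 \<le> summand_exponent \<nu> d x t" for x t
    by (cases "(\<nu>, d, x, t)" rule: summand_exponent.cases) auto
  moreover have "\<exists>\<tau><n. \<forall>x\<in>tilting_index n d. summand_exponent \<nu> d x \<tau> < d k \<tau>" if k: "k < n" for k
  proof -
    obtain \<tau> where \<tau>: "\<tau> < n" "\<nu> \<tau> = k"
      using nak k permutes_image[of \<nu> "{..<n}"] unfolding nakayama_condition_def
      by (metis imageE lessThan_iff)
    have "summand_exponent \<nu> d x \<tau> < d k \<tau>" if x: "x \<in> tilting_index n d" for x
    proof (cases x)
      case None
      then show ?thesis using b[OF \<tau>(1)] \<tau>(2) by auto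
    next
      case (Some p)
      then obtain i j where ij: "x = Some (i, j)" "i < n" "1 \<le> j" "j \<le> d (\<nu> i) i - 1"
        using x by (auto simp: tilting_index_def p_invariant_def b_invariant_def nu)
      then have two: "d (\<nu> i) i = 2" "j = 1" using b[OF ij(2)] by auto
      have "d (\<nu> i) \<tau> + d \<tau> i = 2" using nak ij(2) \<tau>(1) two by (simp add: nakayama_condition_def)
      moreover have "0 \<le> d \<tau> i" using nonneg ij(2) \<tau>(1) by (simp add: nonneg_graded_def)
      moreover have "d k \<tau> = 1 \<Longrightarrow> 0 < d \<tau> i" using sep[OF \<tau>(1) ij(2)] two \<tau>(2) by simp
      ultimately show ?thesis using b[OF \<tau>(1)] \<tau>(2) ij(1) two by auto
    qed
    then show ?thesis using \<tau>(1) by blast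
  qed
  ultimately have "algebra_isomorphic (stable_End n d V) Inc" by (intro stable_End_V)
  then show ?thesis using V_CM unfolding V by blast
qed

section \<open>The tiled order of a finite poset\<close>

text \<open>The order with exponent \<open>1\<close> off the diagonal has Nakayama permutation the transposition and both
  \<open>b\<close>-invariants equal to \<open>1\<close>, so \<open>[R R]\<close> is the only summand. It is not projective, because every
  row of exponents of the order has the difference \<open>1\<close> between its two entries.\<close>

lemma singleton_poset_realization:
  fixes P :: "'p set" and r :: "'p rel"
  assumes P: "P = {p}" and order: "partial_order_on P r"
  shows "\<exists>n d. tiled_order_exponents n d \<and> basic n d \<and> nonneg_graded n d \<and> gorenstein n d \<and>
    (\<forall>i<n. b_invariant n d i \<in> {1, 2}) \<and>
    CM_object n d
      (standard_tilting n d :: ('k::field laurent mat, (nat \<times> int) option \<Rightarrow> 'k laurent mat) gmodule) \<and>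
    algebra_isomorphic
      (stable_End n d
        (standard_tilting n d :: ('k laurent mat, (nat \<times> int) option \<Rightarrow> 'k laurent mat) gmodule))
      (incidence_algebra P r)"
proof -
  define d :: "nat \<Rightarrow> nat \<Rightarrow> int" where "d i j = (if i = j then 0 else 1)" for i j
  define \<nu> :: "nat \<Rightarrow> nat" where "\<nu> = transpose 0 1"
  have two: "i < 2 \<longleftrightarrow> i = 0 \<or> i = 1" for i :: nat by auto
  have \<nu>: "\<nu> 0 = 1" "\<nu> (Suc 0) = 0" by (simp_all add: \<nu>_def)
  have tiled: "tiled_order_exponents 2 d" and basic: "basic 2 d" and nonneg: "nonneg_graded 2 d"
    by (auto simp: tiled_order_exponents_def basic_def nonneg_graded_def d_def)
  have nak: "nakayama_condition 2 d \<nu>"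
    unfolding nakayama_condition_def
    by (auto simp: \<nu>_def[symmetric] \<nu> d_def two) (auto simp: \<nu>_def intro!: permutes_swap_id)
  have nu: "nakayama 2 d = \<nu>" by (rule nakayama_eq[OF basic nak])
  have b: "d (\<nu> i) i = 1" if "i < 2" for i using that by (auto simp: two \<nu> d_def)
  have index: "tilting_index 2 d = {None}"
    using b by (auto simp: tilting_index_def p_invariant_def b_invariant_def nu)
  have "(p, p) \<in> r" using partial_order_onD(1)[OF order] P by (simp add: refl_on_def)
  then have "CM_object 2 d
      (standard_tilting 2 d :: ('k laurent mat, (nat \<times> int) option \<Rightarrow> 'k laurent mat) gmodule) \<and>
    algebra_isomorphic
      (stable_End 2 d
        (standard_tilting 2 d :: ('k laurent mat, (nat \<times> int) option \<Rightarrow> 'k laurent mat) gmodule))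
      (incidence_algebra P r)"
    by (intro standard_tilting_stable_End[OF tiled basic nonneg nak _ _ order, of "\<lambda>_. p"])
      (auto simp: b index P bij_betw_def)
  then show ?thesis
    using tiled basic nonneg nak b
    by (intro exI[of _ 2] exI[of _ d]) (auto simp: gorenstein_def b_invariant_def nu)
qed

text \<open>The size is \<open>2 m\<close> with \<open>m\<close> the number of elements other than the maximum; the index \<open>i < m\<close> stands for the
  element \<open>q i\<close>, and \<open>i + m\<close> for its copy in the second block. The function \<open>base\<close> sends both to \<open>i\<close>. The summand
  that belongs to \<open>i < m\<close> has as exponents the indicator function of the up-set of \<open>q i\<close>, because the entries
  \<open>2 - D\<close> of the lower left block exceed \<open>1\<close> exactly there and those of the lower right block never do.\<close>

lemma nontrivial_poset_realization:
  fixes P :: "'p set" and r :: "'p rel"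
  assumes fin: "finite P" and order: "partial_order_on P r"
    and maxi: "maxi \<in> P" "\<And>x. x \<in> P \<Longrightarrow> (x, maxi) \<in> r" and nontrivial: "P \<noteq> {maxi}"
  shows "\<exists>n d. tiled_order_exponents n d \<and> basic n d \<and> nonneg_graded n d \<and> gorenstein n d \<and>
    (\<forall>i<n. b_invariant n d i \<in> {1, 2}) \<and>
    CM_object n d
      (standard_tilting n d :: ('k::field laurent mat, (nat \<times> int) option \<Rightarrow> 'k laurent mat) gmodule) \<and>
    algebra_isomorphic
      (stable_End n d
        (standard_tilting n d :: ('k laurent mat, (nat \<times> int) option \<Rightarrow> 'k laurent mat) gmodule))
      (incidence_algebra P r)"
proof -
  define Q where "Q = P - {maxi}"
  define m where "m = card Q"
  have finQ: "finite Q" and "Q \<noteq> {}" using fin nontrivial maxi by (auto simp: Q_def)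
  then have m_pos: "0 < m" by (simp add: m_def card_gt_0_iff)
  obtain q where q: "bij_betw q {..<m} Q"
    using ex_bij_betw_nat_finite[OF finQ] by (auto simp: m_def atLeast0LessThan)
  have q_Q: "q i \<in> P" "q i \<noteq> maxi" if "i < m" for i
    using bij_betwE[OF q] that by (auto simp: Q_def)
  have q_inj: "q i = q j \<longleftrightarrow> i = j" if "i < m" "j < m" for i j
    using bij_betw_imp_inj_on[OF q] that by (auto simp: inj_on_def)
  define D :: "nat \<Rightarrow> nat \<Rightarrow> int" where "D i j = (if (q j, q i) \<in> r then 0 else 1)" for i j
  have D01: "D i j = 0 \<or> D i j = 1" for i j by (simp add: D_def)
  have D_ge: "0 \<le> D i j" and D_le: "D i j \<le> 1" for i j by (simp_all add: D_def)
  have D_refl: "D i i = 0" if "i < m" for i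
    using partial_order_onD(1)[OF order] q_Q(1)[OF that] by (simp add: D_def refl_on_def)
  have D_trans: "D i j \<le> D i l + D l j" for i l j
    using partial_order_onD(2)[OF order] unfolding D_def trans_def by auto
  have D_antisym: "1 \<le> D i j + D j i" if "i < m" "j < m" "i \<noteq> j" for i j
    using partial_order_onD(3)[OF order] q_inj[OF that(1,2)] that(3) unfolding D_def antisym_def by auto

  define base where "base i = (if i < m then i else i - m)" for i
  define d where "d i j = (if i < m
    then if j < m then D (base i) (base j) else 1 - D (base j) (base i)
    else if j < m then 2 - D (base j) (base i) else D (base i) (base j))" for i j
  define n where "n = 2 * m"
  define \<nu> where "\<nu> i = (if i < m then i + m else if i < n then i - m else i)" for i
  have base: "base i < m" if "i < n" for i using that by (auto simp: base_def n_def)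
  have base_\<nu>: "base (\<nu> i) = base i" "\<nu> i < m \<longleftrightarrow> \<not> i < m" if "i < n" for i
    using that by (auto simp: base_def \<nu>_def n_def)
  have base_inj: "i = j" if "base i = base j" "i < m \<longleftrightarrow> j < m" for i j
    using that by (auto simp: base_def split: if_splits)

  have tiled: "tiled_order_exponents n d"
    unfolding tiled_order_exponents_def
  proof (intro conjI allI impI)
    show "1 \<le> n" using m_pos by (simp add: n_def)
    show "d i i = 0" if "i < n" for i using D_refl[OF base[OF that]] by (simp add: d_def)
    \<comment> \<open>each of the eight choices of blocks is an instance of \<open>D_trans\<close>, or a consequence of \<open>0 \<le> D \<le> 1\<close>\<close>
    show "d i j \<le> d i l + d l j" for i l j
    proof -
      note D_trans[of "base i" "base j" "base l"] D_trans[of "base j" "base l" "base i"]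
        D_trans[of "base l" "base j" "base i"] D_trans[of "base l" "base i" "base j"]
        D_trans[of "base j" "base i" "base l"] D_trans[of "base i" "base l" "base j"]
        D_ge[of "base i" "base j"] D_ge[of "base i" "base l"] D_ge[of "base l" "base j"]
        D_ge[of "base j" "base i"] D_ge[of "base l" "base i"] D_ge[of "base j" "base l"]
        D_le[of "base i" "base j"] D_le[of "base i" "base l"] D_le[of "base l" "base j"]
        D_le[of "base j" "base i"] D_le[of "base l" "base i"] D_le[of "base j" "base l"]
      then show ?thesis
        by (cases "i < m"; cases "l < m"; cases "j < m"; simp only: d_def if_True if_False; linarith)
    qed
  qed
  have nonneg: "nonneg_graded n d"
    unfolding nonneg_graded_def d_def using D01 by (smt (verit))
  have basic: "basic n d"
    unfolding basic_def
  proof (intro allI impI)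
    fix i j assume ij: "i < n" "j < n" "i \<noteq> j"
    show "0 < d i j + d j i"
    proof (cases "base i = base j")
      case True
      \<comment> \<open>\<open>i\<close> and \<open>j\<close> are the two copies of one element, so the exponents are \<open>1\<close> and \<open>2\<close>\<close>
      then have "(i < m) \<noteq> (j < m)" using base_inj ij(3) by blast
      then show ?thesis using D_refl[OF base[OF ij(2)]] True by (auto simp: d_def)
    next
      case False
      show ?thesis
        using D_antisym[OF base[OF ij(1)] base[OF ij(2)] False]
          D01[of "base i" "base j"] D01[of "base j" "base i"]
        by (auto simp: d_def)
    qed
  qed
  have \<nu>_perm: "\<nu> permutes {..<n}"
  proof (rule bij_imp_permutes)
    show "bij_betw \<nu> {..<n} {..<n}"
      by (rule bij_betwI[where g = \<nu>]) (auto simp: \<nu>_def n_def)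
    show "\<nu> i = i" if "i \<notin> {..<n}" for i using that by (auto simp: \<nu>_def n_def)
  qed
  have b_eq: "d (\<nu> i) i = (if i < m then 2 else 1)" if "i < n" for i
    using base_\<nu>[OF that] D_refl[OF base[OF that]] by (simp add: d_def)
  have nak: "nakayama_condition n d \<nu>"
    unfolding nakayama_condition_def
  proof (intro conjI \<nu>_perm allI impI)
    fix i j assume "i < n" "j < n"
    then show "d (\<nu> i) j + d j i = d (\<nu> i) i"
      using base_\<nu>[of i] by (simp add: b_eq) (simp add: d_def)
  qed
  have nu: "nakayama n d = \<nu>" by (rule nakayama_eq[OF basic nak])
  have index: "tilting_index n d = insert None ((\<lambda>i. Some (i, 1)) ` {..<m})"
  proof -
    have p: "- p_invariant n d i = (if i < m then 1 else 0)" if "i < n" for i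
      unfolding p_invariant_def b_invariant_def nu b_eq[OF that] by simp
    have "i < n \<and> 1 \<le> j \<and> j \<le> - p_invariant n d i \<longleftrightarrow> i < m \<and> j = 1" for i and j :: int
    proof (cases "i < n")
      case True
      then show ?thesis unfolding p[OF True] by auto
    next
      case False
      then show ?thesis by (simp add: n_def)
    qed
    then show ?thesis unfolding tilting_index_def by auto
  qed
  have expo: "summand_exponent \<nu> d (Some (i, 1)) t = (if t < m \<and> (q i, q t) \<in> r then 1 else 0)"
    if "i < m" "t < n" for i t
    using that D01[of "base i" "base t"] base_\<nu>[of i]
    by (auto simp: d_def n_def D_def base_def)
  define \<eta> where "\<eta> x = (case x of None \<Rightarrow> maxi | Some (i, j) \<Rightarrow> q i)" for x :: "(nat \<times> int) option"
  have \<eta>_bij: "bij_betw \<eta> (tilting_index n d) P"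
  proof -
    have "inj_on \<eta> (tilting_index n d)"
      using q_inj q_Q by (auto simp: inj_on_def index \<eta>_def)
    moreover have "\<eta> ` tilting_index n d = insert maxi (q ` {..<m})"
      by (auto simp: index \<eta>_def image_iff)
    moreover have "insert maxi (q ` {..<m}) = P"
      using q maxi(1) by (auto simp: bij_betw_def Q_def)
    ultimately show ?thesis by (simp add: bij_betw_def)
  qed
  have \<eta>_order: "(\<eta> x, \<eta> y) \<in> r \<longleftrightarrow> (\<forall>t<n. summand_exponent \<nu> d y t \<le> summand_exponent \<nu> d x t)"
    if x: "x \<in> tilting_index n d" and y: "y \<in> tilting_index n d" for x y
  proof (cases y)
    case None
    then show ?thesis using x maxi q_Q expo by (auto simp: index \<eta>_def)
  next
    case (Some p)
    then obtain j where y: "y = Some (j, 1)" "j < m" using y by (auto simp: index)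
    have jj: "(q j, q j) \<in> r" using D_refl[OF y(2)] by (auto simp: D_def split: if_splits)
    have jn: "j < n" using y(2) by (simp add: n_def)
    show ?thesis
    proof (cases x)
      case None
      \<comment> \<open>column \<open>j\<close> witnesses that the exponents of \<open>q j\<close> are not zero\<close>
      have "(maxi, q j) \<notin> r"
        using maxi(2)[OF q_Q(1)[OF y(2)]] q_Q(2)[OF y(2)] partial_order_onD(3)[OF order]
        unfolding antisym_def by blast
      moreover have "\<not> summand_exponent \<nu> d y j \<le> summand_exponent \<nu> d x j"
        unfolding y(1) None expo[OF y(2) jn] using jj y(2) by simp
      ultimately show ?thesis using jn y(1) None by (auto simp: \<eta>_def)
    next
      case (Some p')
      then obtain i where x: "x = Some (i, 1)" "i < m" using x by (auto simp: index)
      have "(q i, q j) \<in> r \<longleftrightarrow> (\<forall>t<n. (if t < m \<and> (q j, q t) \<in> r then 1 else 0 :: int)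
          \<le> (if t < m \<and> (q i, q t) \<in> r then 1 else 0))"
      proof
        assume "(q i, q j) \<in> r"
        then have "(q i, q t) \<in> r" if "(q j, q t) \<in> r" for t
          using that by (rule transD[OF partial_order_onD(2)[OF order]])
        then show "\<forall>t<n. (if t < m \<and> (q j, q t) \<in> r then 1 else 0 :: int)
          \<le> (if t < m \<and> (q i, q t) \<in> r then 1 else 0)" by simp
      next
        assume "\<forall>t<n. (if t < m \<and> (q j, q t) \<in> r then 1 else 0 :: int)
          \<le> (if t < m \<and> (q i, q t) \<in> r then 1 else 0)"
        from this[rule_format, OF jn] show "(q i, q j) \<in> r"
          using jj y(2) by (simp split: if_splits)
      qed
      then show ?thesis using expo x(2) y(2) by (simp add: x(1) y(1) \<eta>_def)
    qed
  qed
  have "CM_object n d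
      (standard_tilting n d :: ('k laurent mat, (nat \<times> int) option \<Rightarrow> 'k laurent mat) gmodule) \<and>
    algebra_isomorphic
      (stable_End n d
        (standard_tilting n d :: ('k laurent mat, (nat \<times> int) option \<Rightarrow> 'k laurent mat) gmodule))
      (incidence_algebra P r)"
  proof (rule standard_tilting_stable_End[OF tiled basic nonneg nak _ _ order \<eta>_bij \<eta>_order])
    show "d (\<nu> i) i \<in> {1, 2}" if "i < n" for i using b_eq[OF that] by simp
    show "0 < d t i" if "t < n" "i < n" "d (\<nu> t) t = 1" "d (\<nu> i) i = 2" for t i
    proof -
      \<comment> \<open>\<open>t\<close> is in the second block and \<open>i\<close> in the first, so \<open>d t i\<close> is an entry of \<open>2 - D\<^sup>T\<close>\<close>
      have "\<not> t < m" "i < m" using that b_eq by (auto split: if_splits)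
      then show ?thesis using D01[of "base i" "base t"] by (auto simp: d_def)
    qed
  qed
  then show ?thesis
    using tiled basic nonneg nak b_eq
    by (intro exI[of _ n] exI[of _ d]) (auto simp: gorenstein_def b_invariant_def nu)
qed

theorem theorem4p5:
  fixes P :: "'p set" and r :: "'p rel"
  assumes "finite P"
    and "partial_order_on P r"
    and "\<exists>top\<in>P. \<forall>x\<in>P. (x, top) \<in> r"
  shows "\<exists>n d. tiled_order_exponents n d \<and> basic n d \<and> nonneg_graded n d \<and> gorenstein n d \<and>
    (\<forall>i<n. b_invariant n d i \<in> {1, 2}) \<and>
    CM_object n d
      (standard_tilting n d :: ('k::field laurent mat, (nat \<times> int) option \<Rightarrow> 'k laurent mat) gmodule) \<and>
    algebra_isomorphic
      (stable_End n d
        (standard_tilting n d :: ('k laurent mat, (nat \<times> int) option \<Rightarrow> 'k laurent mat) gmodule))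
      (incidence_algebra P r)"
proof -
  obtain maxi where "maxi \<in> P" "\<And>x. x \<in> P \<Longrightarrow> (x, maxi) \<in> r" using assms(3) by blast
  then show ?thesis
    using singleton_poset_realization[of P maxi r, OF _ assms(2)]
      nontrivial_poset_realization[OF assms(1,2), of maxi] by blast
qed

end
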